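(* Let $L>0$ and let $\gamma=(\gamma_j)_{j\in\mathbb{Z}}$ be a strictly positive symmetric sequence ($\gamma_{-j}=\gamma_j$) with $\gamma_0=1$ and $(\gamma_n)_{n\in\mathbb{N}_0}$ non-decreasing. For $n\in\mathbb{N}$ let $$k_n^*=\operatorname*{argmin}_{k\in\mathbb{N}_0}\max\left\{\gamma_k^{-2},\frac{2k+1}{n}\right\},\qquad \Psi_n=\max\left\{\gamma_{k_n^*}^{-2},\frac{2k_n^*+1}{n}\right\}.$$ Assume further that (C1) $\Gamma=\sum_{j\in\mathbb{Z}}\gamma_j^{-2}<\infty$, and (C2) $0<\eta^{-1}=\inf_{n\in\mathbb{N}}\Psi_n^{-1}\min\left\{\gamma_{k_n^*}^{-2},\frac{2k_n^*+1}{n}\right\}$ for some $\eta\ge1$. Then there is a constant $c>0$ depending only on $\eta$, $L$ and $\Gamma$ such that, for any $n\in\mathbb{N}$, $$\inf_{\widetilde\lambda}\ \sup_{\lambda\in\Lambda(\gamma,L)}\mathbb{E}\big[\|\widetilde\lambda-\lambda\|^2\big]\ge c\,\Psi_n,$$ where the infimum is taken over all estimators $\widetilde\lambda$ of $\lambda$ based on the sample $N_1,\ldots,N_n$.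
   Context: $\mathbb{L}^2=\mathbb{L}^2([0,1],\mathrm{d}x)$ with norm $\|\cdot\|$. The orthonormal basis $\{\phi_j\}_{j\in\mathbb{Z}}$ of $\mathbb{L}^2$ is $\phi_0=1$, $\phi_j(t)=\sqrt2\cos(2\pi jt)$, $\phi_{-j}(t)=\sqrt2\sin(2\pi jt)$ for $j=1,2,\ldots$. For $\lambda\in\mathbb{L}^2$, $\beta_j=\int_0^1\lambda(t)\phi_j(t)\,\mathrm{d}t$. The class of intensities is $$\Lambda(\gamma,L)=\Big\{\lambda\in\mathbb{L}^2:\ \lambda\ge0,\ \sum_{j\in\mathbb{Z}}\gamma_j^2\beta_j^2\le L^2\Big\}.$$ One observes $N_1,\ldots,N_n$, i.i.d. Poisson point processes on $[0,1]$ with intensity function $\lambda$ (with respect to Lebesgue measure); $\mathbb{E}$ is the expectation under the true intensity $\lambda$. An estimator is a measurable function of $(N_1,\ldots,N_n)$ with values in $\mathbb{L}^2$. *)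

theory Defs
  imports "HOL-Probability.Probability"
begin

section \<open>The space of square-integrable functions on the unit interval\<close>

abbreviation unit_interval :: "real measure" where
  "unit_interval \<equiv> restrict_space lborel {0..1}"

text \<open>Elements of the Hilbert space are represented by functions, not by almost-everywhere
  classes; hence \<open>l2_norm\<close> is only a seminorm. Values outside \<open>{0..1}\<close> are irrelevant.\<close>

definition l2_space :: "(real \<Rightarrow> real) set" where
  "l2_space = {f. f \<in> borel_measurable unit_interval \<and> integrable unit_interval (\<lambda>x. (f x)\<^sup>2)}"

definition l2_norm :: "(real \<Rightarrow> real) \<Rightarrow> real" where
  "l2_norm f = sqrt (\<integral>x. (f x)\<^sup>2 \<partial>unit_interval)"

definition l2_open :: "(real \<Rightarrow> real) set \<Rightarrow> bool" where
  "l2_open U \<longleftrightarrow> U \<subseteq> l2_space \<and>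
     (\<forall>f\<in>U. \<exists>e>0. \<forall>g\<in>l2_space. l2_norm (\<lambda>x. g x - f x) < e \<longrightarrow> g \<in> U)"

text \<open>The Borel sigma-algebra of the norm topology. Every open set is a union of
  almost-everywhere classes, so this is the Borel sigma-algebra of the quotient.\<close>

definition l2_borel :: "(real \<Rightarrow> real) measure" where
  "l2_borel = sigma l2_space {U. l2_open U}"

definition trig_basis :: "int \<Rightarrow> real \<Rightarrow> real" where
  "trig_basis j t =
     (if j = 0 then 1
      else if j > 0 then sqrt 2 * cos (2 * pi * of_int j * t)
      else sqrt 2 * sin (2 * pi * of_int (- j) * t))"

definition fourier_coeff :: "(real \<Rightarrow> real) \<Rightarrow> int \<Rightarrow> real" where
  "fourier_coeff f j = (\<integral>t. f t * trig_basis j t \<partial>unit_interval)"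

definition intensity_class :: "(int \<Rightarrow> real) \<Rightarrow> real \<Rightarrow> (real \<Rightarrow> real) set" where
  "intensity_class \<gamma> L =
     {f \<in> l2_space. (AE x in unit_interval. 0 \<le> f x) \<and>
        (\<lambda>j. (\<gamma> j)\<^sup>2 * (fourier_coeff f j)\<^sup>2) summable_on UNIV \<and>
        (\<Sum>\<^sub>\<infinity>j. (\<gamma> j)\<^sup>2 * (fourier_coeff f j)\<^sup>2) \<le> L\<^sup>2}"

section \<open>Poisson point processes\<close>

text \<open>A realisation is a counting measure on the unit interval, finite because the interval is
  compact. Taking \<open>A = {0..1}\<close> in the definition yields finiteness.\<close>

definition point_measures :: "real measure set" where
  "point_measures = {\<mu>. sets \<mu> = sets unit_interval \<and>
     (\<forall>A\<in>sets unit_interval. \<exists>k::nat. emeasure \<mu> A = of_nat k)}"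

text \<open>The smallest sigma-algebra making all counting maps \<open>\<mu> \<mapsto> \<mu>(A)\<close> measurable.\<close>

definition point_space :: "real measure measure" where
  "point_space = sigma point_measures
     {{\<mu> \<in> point_measures. emeasure \<mu> A \<in> B} | A B. A \<in> sets unit_interval \<and> B \<in> sets borel}"

text \<open>The Poisson probabilities are written out because \<open>poisson_pmf\<close> excludes the
  degenerate parameter \<open>0\<close>, which occurs whenever the intensity vanishes on \<open>A\<close>.\<close>

definition poisson_point_process ::
    "'a measure \<Rightarrow> ('a \<Rightarrow> real measure) \<Rightarrow> (real \<Rightarrow> real) \<Rightarrow> bool" where
  "poisson_point_process M N f \<longleftrightarrow>
     prob_space M \<and> N \<in> measurable M point_space \<and>
     (\<forall>A\<in>sets unit_interval. \<forall>k::nat.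
        measure M {\<omega> \<in> space M. emeasure (N \<omega>) A = of_nat k} =
          exp (- set_lebesgue_integral unit_interval A f) *
          (set_lebesgue_integral unit_interval A f) ^ k / fact k) \<and>
     (\<forall>F. finite F \<and> F \<subseteq> sets unit_interval \<and> disjoint F \<longrightarrow>
        prob_space.indep_vars M (\<lambda>_. borel) (\<lambda>A \<omega>. emeasure (N \<omega>) A) F)"

text \<open>\<open>Q\<close> is the law, on the space of realisations, of a Poisson point process with
  intensity \<open>f\<close>.\<close>

definition poisson_law :: "(real \<Rightarrow> real) \<Rightarrow> real measure measure \<Rightarrow> bool" where
  "poisson_law f Q \<longleftrightarrow> sets Q = sets point_space \<and> poisson_point_process Q (\<lambda>\<mu>. \<mu>) f"

section \<open>Estimators, risk and rates\<close>

definition estimators :: "nat \<Rightarrow> ((nat \<Rightarrow> real measure) \<Rightarrow> real \<Rightarrow> real) set" where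
  "estimators n = measurable (PiM {1..n} (\<lambda>_. point_space)) l2_borel"

text \<open>Mean integrated squared error when the observations are i.i.d. with law \<open>Q\<close>;
  it may be infinite.\<close>

definition risk :: "nat \<Rightarrow> real measure measure \<Rightarrow>
    ((nat \<Rightarrow> real measure) \<Rightarrow> real \<Rightarrow> real) \<Rightarrow> (real \<Rightarrow> real) \<Rightarrow> ennreal" where
  "risk n Q T f = (\<integral>\<^sup>+N. ennreal ((l2_norm (\<lambda>x. T N x - f x))\<^sup>2) \<partial>PiM {1..n} (\<lambda>_. Q))"

definition sq_bias :: "(int \<Rightarrow> real) \<Rightarrow> nat \<Rightarrow> real" where
  "sq_bias \<gamma> k = 1 / (\<gamma> (int k))\<^sup>2"

definition var_term :: "nat \<Rightarrow> nat \<Rightarrow> real" where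
  "var_term n k = (2 * real k + 1) / real n"

text \<open>The minimiser need not be unique: \<open>sq_bias \<gamma>\<close> may be constant on a stretch on which
  it dominates. The maximum \<open>rate\<close> does not depend on the choice, but the minimum in the balance
  condition does, so \<open>k\<close> ranges over arbitrary selections of minimisers.\<close>

definition optimal_dims :: "(int \<Rightarrow> real) \<Rightarrow> (nat \<Rightarrow> nat) \<Rightarrow> bool" where
  "optimal_dims \<gamma> k \<longleftrightarrow>
     (\<forall>n\<ge>1. is_arg_min (\<lambda>m. max (sq_bias \<gamma> m) (var_term n m)) (\<lambda>_. True) (k n))"

definition rate :: "(int \<Rightarrow> real) \<Rightarrow> (nat \<Rightarrow> nat) \<Rightarrow> nat \<Rightarrow> real" where
  "rate \<gamma> k n = max (sq_bias \<gamma> (k n)) (var_term n (k n))"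

definition weight_sequence :: "(int \<Rightarrow> real) \<Rightarrow> bool" where
  "weight_sequence \<gamma> \<longleftrightarrow>
     (\<forall>j. \<gamma> j > 0) \<and> (\<forall>j. \<gamma> (- j) = \<gamma> j) \<and> \<gamma> 0 = 1 \<and> mono (\<lambda>n::nat. \<gamma> (int n))"

end

theory Submission
  imports Defs
begin

text \<open>
  The proof is Assouad's. Around the constant intensity \<open>L / 2\<close> sits a cube of
  \<open>2 ^ (2 k + 1)\<close> intensities, obtained by adding \<open>a\<close> or \<open>- a\<close> to each Fourier coefficient
  with index in \<open>{- k..k}\<close>, where \<open>a\<^sup>2 = \<zeta> / n\<close> and \<open>k\<close> stands for \<open>k n\<close>. Two requirements pin down \<open>\<zeta>\<close>.
  The cube has to lie in the intensity class (\<open>vertex_intensity_in_class\<close>): the ellipsoid condition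
  costs \<open>a\<^sup>2 (2 k + 1) \<gamma>\<^sub>k\<^sup>2\<close>, which the balance condition bounds by \<open>\<zeta> \<eta>\<close>; nonnegativity costs
  \<open>a (2 k + 1)\<close>, whose square is bounded by \<open>\<zeta> \<eta> \<Gamma>\<close> because \<open>2 k + 1 \<le> \<Gamma> \<gamma>\<^sub>k\<^sup>2\<close>. And two vertices
  joined by an edge must not be told apart by \<open>n\<close> observations. Then any estimator gets each
  of the \<open>2 k + 1\<close> coordinates wrong by at least \<open>a\<close> with probability bounded below, on average over the
  cube, and by Bessel's inequality its risk is at least a constant times
  \<open>(2 k + 1) a\<^sup>2\<close> at some vertex. This is \<open>\<zeta>\<close> times the variance term, which by balance
  reaches the rate up to the factor \<open>\<eta>\<close>.

  The indistinguishability of neighbours (\<open>poisson_sample_error_sum\<close>) says that for laws \<open>P\<close>, \<open>Q\<close>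
  of samples with intensities \<open>f\<close>, \<open>g\<close> and any event \<open>E\<close>, the error sum \<open>P E + Q (- E)\<close> is bounded below.
  It is proved without densities between the laws of the point processes. If \<open>E\<close> depends only on
  the numbers of points in finitely many sets, one may replace these sets by a finite partition of the unit
  interval; the counts on the cells are then independent Poisson variables, and the Hellinger affinity
  of their joint distributions is the product of the affinities \<open>exp (- (sqrt \<mu> - sqrt \<nu>)\<^sup>2 / 2)\<close>
  of Poisson distributions with means \<open>\<mu>\<close> and \<open>\<nu>\<close>. The product is bounded below uniformly in the partition,
  because each exponent is bounded by a fixed multiple of the length of its cell. A
  Cauchy-Schwarz argument turns affinity into error sum (\<open>affinity_le_error_roots\<close>). Finally, such
  events form an algebra which generates the \<open>\<sigma>\<close>-algebra of the sample space, so any event is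
  approximated by them in \<open>P\<close> and \<open>Q\<close> simultaneously (\<open>approximable_by_algebra\<close>), and the bound extends to it.
\<close>

section \<open>The trigonometric basis\<close>

lemma prob_space_unit_interval: "prob_space unit_interval"
  by (rule prob_space_restrict_space) auto

lemma integral_unit_interval_FTC:
  assumes "\<And>x. (F has_real_derivative f x) (at x)" "continuous_on UNIV f"
  shows "(\<integral>x. f x \<partial>unit_interval) = F 1 - F 0"
proof -
  have "(\<integral>x. f x \<partial>unit_interval) = (\<integral>x. f x * indicator {0..1} x \<partial>lborel)"
    by (subst integral_restrict_space) (auto simp: mult.commute)
  also have "\<dots> = F 1 - F 0"
    by (rule integral_FTC_Icc_real) (use assms in \<open>auto simp: continuous_on_eq_continuous_at\<close>)
  finally show ?thesis .
qed

lemma integral_cos_period: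
  "(\<integral>t. cos (2 * pi * of_int m * t) \<partial>unit_interval) = (if m = 0 then 1 else 0)"
proof (cases "m = 0")
  case True
  then show ?thesis using prob_space.prob_space[OF prob_space_unit_interval] by simp
next
  case False
  have "(\<integral>t. cos (2 * pi * of_int m * t) \<partial>unit_interval)
      = sin (2 * pi * of_int m * 1) / (2 * pi * of_int m) - sin (2 * pi * of_int m * 0) / (2 * pi * of_int m)"
    by (rule integral_unit_interval_FTC)
       (use False in \<open>auto intro!: derivative_eq_intros continuous_intros\<close>)
  also have "\<dots> = 0" using sin_int_2pin[of m] by (simp add: mult.assoc)
  finally show ?thesis using False by simp
qed

lemma integral_sin_period: "(\<integral>t. sin (2 * pi * of_int m * t) \<partial>unit_interval) = 0"
proof (cases "m = 0")
  case True
  then show ?thesis by simp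
next
  case False
  have "(\<integral>t. sin (2 * pi * of_int m * t) \<partial>unit_interval)
      = - cos (2 * pi * of_int m * 1) / (2 * pi * of_int m) - - cos (2 * pi * of_int m * 0) / (2 * pi * of_int m)"
    by (rule integral_unit_interval_FTC)
       (use False in \<open>auto intro!: derivative_eq_intros continuous_intros\<close>)
  also have "\<dots> = 0" using cos_int_2pin[of m] by (simp add: mult.assoc)
  finally show ?thesis .
qed

lemma measurable_trig_basis [measurable]: "trig_basis j \<in> borel_measurable borel"
  unfolding trig_basis_def[abs_def] by measurable

lemma measurable_trig_basis_unit [measurable]: "trig_basis j \<in> borel_measurable unit_interval"
  by (rule measurable_restrict_space1) (simp add: measurable_trig_basis)

lemma trig_basis_bound: "\<bar>trig_basis j t\<bar> \<le> sqrt 2"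
proof -
  have "sqrt 2 \<ge> (1::real)" by simp
  then show ?thesis
    by (auto simp: trig_basis_def abs_mult intro!: mult_left_le)
qed

lemma integrable_unit_interval_bounded:
  assumes "f \<in> borel_measurable unit_interval" "\<And>t. \<bar>f t\<bar> \<le> (C::real)"
  shows "integrable unit_interval f"
  by (rule finite_measure.integrable_const_bound[OF prob_space.finite_measure[OF prob_space_unit_interval], where B = C])
     (use assms in auto)

text \<open>Product-to-sum formulas turn every product of basis functions into a combination of
  full periods of sine and cosine; only the constant frequency survives integration.\<close>

lemma trig_basis_orthonormal:
  "(\<integral>t. trig_basis i t * trig_basis j t \<partial>unit_interval) = (if i = j then 1 else 0)"
proof -
  define c where "c m t = cos (2 * pi * of_int m * t)" for m and t :: real
  define s where "s m t = sin (2 * pi * of_int m * t)" for m and t :: real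
  have [measurable]: "c m \<in> borel_measurable unit_interval" "s m \<in> borel_measurable unit_interval" for m
    unfolding c_def[abs_def] s_def[abs_def] by (auto intro!: measurable_restrict_space1)
  have ic[simp]: "integrable unit_interval (c m)" and int_s[simp]: "integrable unit_interval (s m)" for m
    by (auto intro!: integrable_unit_interval_bounded[where C = 1] simp: c_def[abs_def] s_def[abs_def])
      (auto intro!: measurable_restrict_space1)
  have Ic: "(\<integral>t. c m t \<partial>unit_interval) = (if m = 0 then 1 else 0)" for m
    unfolding c_def by (rule integral_cos_period)
  have Is: "(\<integral>t. s m t \<partial>unit_interval) = 0" for m
    unfolding s_def by (rule integral_sin_period)
  have basis: "trig_basis j t = (if j = 0 then 1 else if j > 0 then sqrt 2 * c j t else sqrt 2 * s (- j) t)" for j t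
    by (simp add: trig_basis_def c_def s_def)
  have two: "sqrt 2 * x * (sqrt 2 * y) = 2 * (x * y)" for x y
  proof -
    have "sqrt 2 * x * (sqrt 2 * y) = (sqrt 2 * sqrt 2) * (x * y)" by (simp only: mult_ac)
    then show ?thesis by simp
  qed
  have cc: "sqrt 2 * c p t * (sqrt 2 * c q t) = c (p - q) t + c (p + q) t" for p q t
    using cos_times_cos[of "2 * pi * of_int p * t" "2 * pi * of_int q * t"]
    unfolding two by (simp add: c_def algebra_simps)
  have ss: "sqrt 2 * s p t * (sqrt 2 * s q t) = c (p - q) t - c (p + q) t" for p q t
    using sin_times_sin[of "2 * pi * of_int p * t" "2 * pi * of_int q * t"]
    unfolding two by (simp add: c_def s_def algebra_simps)
  have sc: "sqrt 2 * s p t * (sqrt 2 * c q t) = s (p + q) t + s (p - q) t" for p q t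
    using sin_times_cos[of "2 * pi * of_int p * t" "2 * pi * of_int q * t"]
    unfolding two by (simp add: c_def s_def algebra_simps)
  have cs: "sqrt 2 * c q t * (sqrt 2 * s p t) = s (p + q) t + s (p - q) t" for p q t
    using sc[of p t q] by (simp add: mult.commute)
  have one: "measure unit_interval {0..1} = 1"
    using prob_space.prob_space[OF prob_space_unit_interval] by simp
  consider "i = 0" "j = 0" | "i = 0" "j > 0" | "i = 0" "j < 0" | "i > 0" "j = 0" | "i > 0" "j > 0"
    | "i > 0" "j < 0" | "i < 0" "j = 0" | "i < 0" "j > 0" | "i < 0" "j < 0"
    by linarith
  then show ?thesis
    by cases (auto simp: basis cc ss sc cs one Ic Is)
qed

lemma l2_space_diff:
  assumes "f \<in> l2_space" "g \<in> l2_space"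
  shows "(\<lambda>x. f x - g x) \<in> l2_space"
proof -
  have [measurable]: "f \<in> borel_measurable unit_interval" "g \<in> borel_measurable unit_interval"
    using assms by (auto simp: l2_space_def)
  have "integrable unit_interval (\<lambda>x. 2 * (f x)\<^sup>2 + 2 * (g x)\<^sup>2)"
    using assms by (auto simp: l2_space_def)
  then have "integrable unit_interval (\<lambda>x. (f x - g x)\<^sup>2)"
  proof (rule Bochner_Integration.integrable_bound)
    show "AE x in unit_interval. norm ((f x - g x)\<^sup>2) \<le> norm (2 * (f x)\<^sup>2 + 2 * (g x)\<^sup>2)"
    proof (intro always_eventually allI)
      fix x
      have "(f x - g x)\<^sup>2 + (f x + g x)\<^sup>2 = 2 * (f x)\<^sup>2 + 2 * (g x)\<^sup>2" by (simp add: power2_eq_square algebra_simps)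
      then show "norm ((f x - g x)\<^sup>2) \<le> norm (2 * (f x)\<^sup>2 + 2 * (g x)\<^sup>2)"
        using zero_le_power2[of "f x + g x"] zero_le_power2[of "f x - g x"]
        unfolding real_norm_def by linarith
    qed
  qed measurable
  then show ?thesis by (simp add: l2_space_def)
qed

lemma integrable_mult_trig_basis:
  assumes "f \<in> l2_space"
  shows "integrable unit_interval (\<lambda>x. f x * trig_basis j x)"
proof -
  have [measurable]: "f \<in> borel_measurable unit_interval" using assms by (auto simp: l2_space_def)
  have "integrable unit_interval (\<lambda>x. (f x)\<^sup>2 + 2)"
    using assms finite_measure.integrable_const[OF prob_space.finite_measure[OF prob_space_unit_interval]]
    by (intro Bochner_Integration.integrable_add) (auto simp: l2_space_def)
  then show ?thesis
  proof (rule Bochner_Integration.integrable_bound)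
    show "AE x in unit_interval. norm (f x * trig_basis j x) \<le> norm ((f x)\<^sup>2 + 2)"
    proof (intro always_eventually allI)
      fix x
      have "(trig_basis j x)\<^sup>2 \<le> (sqrt 2)\<^sup>2" using trig_basis_bound by (metis abs_ge_zero power2_abs power_mono)
      moreover have "0 \<le> (\<bar>f x\<bar> - \<bar>trig_basis j x\<bar>)\<^sup>2" by simp
      ultimately have "2 * \<bar>f x * trig_basis j x\<bar> \<le> (f x)\<^sup>2 + 2"
        by (simp add: power2_diff abs_mult)
      then show "norm (f x * trig_basis j x) \<le> norm ((f x)\<^sup>2 + 2)"
        unfolding real_norm_def by linarith
    qed
  qed measurable
qed

lemma fourier_coeff_diff:
  assumes "f \<in> l2_space" "g \<in> l2_space"
  shows "fourier_coeff (\<lambda>x. f x - g x) j = fourier_coeff f j - fourier_coeff g j"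
  using integrable_mult_trig_basis[OF assms(1), of j] integrable_mult_trig_basis[OF assms(2), of j]
  by (simp add: fourier_coeff_def left_diff_distrib)

lemma integrable_trig_basis_prod:
  "integrable unit_interval (\<lambda>t. trig_basis i t * trig_basis j t)"
proof (rule integrable_unit_interval_bounded)
  show "\<bar>trig_basis i t * trig_basis j t\<bar> \<le> sqrt 2 * sqrt 2" for t
    unfolding abs_mult by (intro mult_mono trig_basis_bound) auto
qed measurable

lemma trig_polynomial_norm:
  assumes "finite J"
  shows "integrable unit_interval (\<lambda>t. (\<Sum>j\<in>J. c j * trig_basis j t)\<^sup>2)"
    and "(\<integral>t. (\<Sum>j\<in>J. c j * trig_basis j t)\<^sup>2 \<partial>unit_interval) = (\<Sum>j\<in>J. (c j)\<^sup>2)"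
proof -
  have eq: "(\<Sum>j\<in>J. c j * trig_basis j t)\<^sup>2
      = (\<Sum>i\<in>J. \<Sum>j\<in>J. c i * c j * (trig_basis i t * trig_basis j t))" for t
    by (simp add: power2_eq_square sum_product mult_ac)
  show "integrable unit_interval (\<lambda>t. (\<Sum>j\<in>J. c j * trig_basis j t)\<^sup>2)"
    unfolding eq by (intro Bochner_Integration.integrable_sum integrable_mult_right integrable_trig_basis_prod)
  have "(\<integral>t. (\<Sum>j\<in>J. c j * trig_basis j t)\<^sup>2 \<partial>unit_interval)
      = (\<Sum>i\<in>J. \<Sum>j\<in>J. c i * c j * (\<integral>t. trig_basis i t * trig_basis j t \<partial>unit_interval))"
    unfolding eq by (simp add: Bochner_Integration.integral_sum Bochner_Integration.integrable_sum integrable_trig_basis_prod)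
  also have "\<dots> = (\<Sum>j\<in>J. (c j)\<^sup>2)"
    using assms by (simp add: trig_basis_orthonormal power2_eq_square if_distrib cong: if_cong)
  finally show "(\<integral>t. (\<Sum>j\<in>J. c j * trig_basis j t)\<^sup>2 \<partial>unit_interval) = (\<Sum>j\<in>J. (c j)\<^sup>2)" .
qed

text \<open>Expand the squared norm of the difference between \<open>f\<close> and its projection on the chosen
  basis functions; it is nonnegative.\<close>

lemma bessel_inequality:
  assumes f: "f \<in> l2_space" and J: "finite J"
  shows "(\<Sum>j\<in>J. (fourier_coeff f j)\<^sup>2) \<le> (l2_norm f)\<^sup>2"
proof -
  define p where "p t = (\<Sum>j\<in>J. fourier_coeff f j * trig_basis j t)" for t
  have fp: "integrable unit_interval (\<lambda>t. f t * p t)"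
    and Ifp: "(\<integral>t. f t * p t \<partial>unit_interval) = (\<Sum>j\<in>J. (fourier_coeff f j)\<^sup>2)"
  proof -
    have eq: "f t * p t = (\<Sum>j\<in>J. fourier_coeff f j * (f t * trig_basis j t))" for t
      by (simp add: p_def sum_distrib_left mult_ac)
    show "integrable unit_interval (\<lambda>t. f t * p t)"
      unfolding eq by (intro Bochner_Integration.integrable_sum integrable_mult_right integrable_mult_trig_basis f)
    show "(\<integral>t. f t * p t \<partial>unit_interval) = (\<Sum>j\<in>J. (fourier_coeff f j)\<^sup>2)"
      unfolding eq
      by (simp add: Bochner_Integration.integral_sum integrable_mult_trig_basis f fourier_coeff_def[of f, symmetric]
          power2_eq_square)
  qed
  have ff: "integrable unit_interval (\<lambda>t. (f t)\<^sup>2)" using f by (simp add: l2_space_def)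
  have pp: "integrable unit_interval (\<lambda>t. (p t)\<^sup>2)"
    and Ipp: "(\<integral>t. (p t)\<^sup>2 \<partial>unit_interval) = (\<Sum>j\<in>J. (fourier_coeff f j)\<^sup>2)"
    using trig_polynomial_norm[OF J] by (auto simp: p_def[abs_def])
  have "0 \<le> (\<integral>t. (f t - p t)\<^sup>2 \<partial>unit_interval)" by simp
  also have "\<dots> = (\<integral>t. (f t)\<^sup>2 - 2 * (f t * p t) + (p t)\<^sup>2 \<partial>unit_interval)"
    by (simp add: power2_diff algebra_simps)
  also have "\<dots> = (\<integral>t. (f t)\<^sup>2 \<partial>unit_interval) - 2 * (\<Sum>j\<in>J. (fourier_coeff f j)\<^sup>2) + (\<Sum>j\<in>J. (fourier_coeff f j)\<^sup>2)"
    using ff fp pp by (simp add: Ifp Ipp)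
  also have "(\<integral>t. (f t)\<^sup>2 \<partial>unit_interval) = (l2_norm f)\<^sup>2" by (simp add: l2_norm_def)
  finally show ?thesis by simp
qed

lemma space_l2_borel: "space l2_borel = l2_space"
  unfolding l2_borel_def by (rule space_measure_of) (auto simp: l2_open_def)

text \<open>Bessel's inequality for a single index makes the coefficient a contraction for the
  norm, so it is continuous.\<close>

lemma measurable_fourier_coeff: "(\<lambda>f. fourier_coeff f j) \<in> borel_measurable l2_borel"
proof (rule borel_measurableI_less)
  fix y :: real
  have "l2_open {f \<in> l2_space. fourier_coeff f j < y}"
    unfolding l2_open_def
  proof (intro conjI ballI)
    fix f assume "f \<in> {f \<in> l2_space. fourier_coeff f j < y}"
    then have f: "f \<in> l2_space" "fourier_coeff f j < y" by auto
    show "\<exists>e>0. \<forall>g\<in>l2_space. l2_norm (\<lambda>x. g x - f x) < e \<longrightarrow> g \<in> {f \<in> l2_space. fourier_coeff f j < y}"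
    proof (intro exI[of _ "y - fourier_coeff f j"] conjI ballI impI)
      fix g assume g: "g \<in> l2_space" "l2_norm (\<lambda>x. g x - f x) < y - fourier_coeff f j"
      have "(fourier_coeff g j - fourier_coeff f j)\<^sup>2 \<le> (l2_norm (\<lambda>x. g x - f x))\<^sup>2"
        using bessel_inequality[OF l2_space_diff[OF g(1) f(1)], of "{j}"] fourier_coeff_diff[OF g(1) f(1)] by simp
      then have "fourier_coeff g j - fourier_coeff f j \<le> l2_norm (\<lambda>x. g x - f x)"
        by (rule power2_le_imp_le) (simp add: l2_norm_def)
      then show "g \<in> {f \<in> l2_space. fourier_coeff f j < y}" using g by auto
    qed (use f in auto)
  qed auto
  then show "{f \<in> space l2_borel. fourier_coeff f j < y} \<in> sets l2_borel"
    unfolding space_l2_borel unfolding l2_borel_def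
    by (subst sets_measure_of) (auto simp: l2_open_def)
qed

section \<open>Error sums and generating algebras\<close>

text \<open>The sets that can be approximated from \<open>\<A>\<close> form a \<open>\<sigma>\<close>-algebra. Adding the two measures makes
  one approximating set serve both.\<close>

lemma approximable_by_algebra:
  assumes P: "finite_measure P" and Q: "finite_measure Q" and PQ: "sets Q = sets P"
    and alg: "algebra (space P) \<A>" and sub: "\<A> \<subseteq> sets P"
    and E: "E \<in> sigma_sets (space P) \<A>" and e: "(\<epsilon>::real) > 0"
  shows "\<exists>A\<in>\<A>. measure P (sym_diff E A) + measure Q (sym_diff E A) < \<epsilon>"
proof -
  interpret P: finite_measure P by (rule P)
  interpret Q: finite_measure Q by (rule Q)
  interpret algebra "space P" \<A> by (rule alg)
  note [simp] = PQ
  define m where "m E = measure P E + measure Q E" for E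
  define approx where "approx E \<longleftrightarrow> (\<forall>\<epsilon>>0. \<exists>A\<in>\<A>. m (sym_diff E A) < \<epsilon>)" for E
  have subset_sets: "X \<in> sets P" if "X \<in> \<A>" for X using sub that by auto
  have m_mono: "m X \<le> m Y" if "X \<subseteq> Y" "Y \<in> sets P" for X Y
    unfolding m_def using that by (intro add_mono P.finite_measure_mono Q.finite_measure_mono) auto
  have m_subadd: "m (X \<union> Y) \<le> m X + m Y" if "X \<in> sets P" "Y \<in> sets P" for X Y
    unfolding m_def using measure_Un_le[of X P Y] measure_Un_le[of X Q Y] that
    by auto
  have approx_Un: "approx (X \<union> Y)"
    if X: "approx X" "X \<in> sets P" and Y: "approx Y" "Y \<in> sets P" for X Y
    unfolding approx_def
  proof (intro allI impI)
    fix \<epsilon> :: real assume "\<epsilon> > 0"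
    then obtain A B where A: "A \<in> \<A>" "m (sym_diff X A) < \<epsilon>/2" and B: "B \<in> \<A>" "m (sym_diff Y B) < \<epsilon>/2"
      using X Y unfolding approx_def by (meson half_gt_zero)
    have "m (sym_diff (X \<union> Y) (A \<union> B)) \<le> m (sym_diff X A \<union> sym_diff Y B)"
      using X Y A B subset_sets by (intro m_mono) auto
    also have "\<dots> \<le> m (sym_diff X A) + m (sym_diff Y B)"
      using X Y A B subset_sets by (intro m_subadd) auto
    also have "\<dots> < \<epsilon>" using A B by simp
    finally show "\<exists>A\<in>\<A>. m (sym_diff (X \<union> Y) A) < \<epsilon>" using A B by (meson Un)
  qed
  have sets: "X \<in> sets P" if "X \<in> sigma_sets (space P) \<A>" for X
    using that sub sets.sigma_sets_subset by blast
  from E have "approx E"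
  proof induction
    case (Basic a)
    then show ?case unfolding approx_def by (auto simp: m_def intro!: bexI[of _ a])
  next
    case Empty
    then show ?case unfolding approx_def by (auto simp: m_def intro!: bexI[of _ "{}"])
  next
    case (Compl a)
    show ?case unfolding approx_def
    proof (intro allI impI)
      fix \<epsilon> :: real assume "\<epsilon> > 0"
      then obtain A where A: "A \<in> \<A>" "m (sym_diff a A) < \<epsilon>" using Compl.IH unfolding approx_def by meson
      have "sym_diff (space P - a) (space P - A) = sym_diff a A"
        using sets.sets_into_space[OF sets[OF Compl.hyps]] sets.sets_into_space[OF subset_sets[OF A(1)]] by auto
      with A show "\<exists>A\<in>\<A>. m (sym_diff (space P - a) A) < \<epsilon>"
        by (intro bexI[of _ "space P - A"]) auto
    qed
  next
    case (Union a)
    have am: "a i \<in> sets P" for i using sets[OF Union.hyps] .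
    have part: "approx (\<Union>i<K. a i)" for K
    proof (induction K)
      case 0
      then show ?case unfolding approx_def by (auto simp: m_def intro!: bexI[of _ "{}"])
    next
      case (Suc K)
      then show ?case using approx_Un[of "a K" "\<Union>i<K. a i"] Union.IH am
        by (auto simp: lessThan_Suc)
    qed
    \<comment> \<open>Continuity from below reduces a countable union to a finite one.\<close>
    have lim: "(\<lambda>K. m (\<Union>i<K. a i)) \<longlonglongrightarrow> m (\<Union>i. a i)"
    proof -
      have "(\<Union>K. \<Union>i<K. a i) = (\<Union>i. a i)" by auto
      moreover have "incseq (\<lambda>K. \<Union>i<K. a i)" unfolding incseq_def by (meson UN_mono lessThan_subset_iff subset_refl)
      moreover have "range (\<lambda>K. \<Union>i<K. a i) \<subseteq> sets P" using am by (auto intro!: sets.finite_UN)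
      ultimately show ?thesis unfolding m_def using am
          P.finite_Lim_measure_incseq[of "\<lambda>K. \<Union>i<K. a i"] Q.finite_Lim_measure_incseq[of "\<lambda>K. \<Union>i<K. a i"]
        by (intro tendsto_add) auto
    qed
    show ?case unfolding approx_def
    proof (intro allI impI)
      fix \<epsilon> :: real assume e: "\<epsilon> > 0"
      from order_tendstoD(1)[OF lim, of "m (\<Union>i. a i) - \<epsilon>/2"] e
      obtain K where K: "m (\<Union>i. a i) - \<epsilon>/2 < m (\<Union>i<K. a i)"
        by (auto simp: eventually_sequentially)
      obtain A where A: "A \<in> \<A>" "m (sym_diff (\<Union>i<K. a i) A) < \<epsilon>/2"
        using part[of K] e unfolding approx_def by (meson half_gt_zero)
      have "m ((\<Union>i. a i) - (\<Union>i<K. a i)) = m (\<Union>i. a i) - m (\<Union>i<K. a i)"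
        unfolding m_def using am
        by (subst P.finite_measure_Diff, force, force, force, subst Q.finite_measure_Diff) auto
      moreover have "m (sym_diff (\<Union>i. a i) A) \<le> m (((\<Union>i. a i) - (\<Union>i<K. a i)) \<union> sym_diff (\<Union>i<K. a i) A)"
        using am A subset_sets by (intro m_mono) auto
      moreover have "\<dots> \<le> m ((\<Union>i. a i) - (\<Union>i<K. a i)) + m (sym_diff (\<Union>i<K. a i) A)"
        using am A subset_sets by (intro m_subadd) auto
      ultimately show "\<exists>A\<in>\<A>. m (sym_diff (\<Union>i. a i) A) < \<epsilon>" using A K by force
    qed
  qed
  then show ?thesis using e unfolding approx_def m_def by auto
qed

text \<open>Replacing \<open>E\<close> by \<open>A\<close> changes the two error probabilities by at most the measures of their
  symmetric difference, which can be made arbitrarily small.\<close>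

lemma error_sum_ge_from_algebra:
  assumes P: "prob_space P" and Q: "prob_space Q" and PQ: "sets Q = sets P"
    and alg: "algebra (space P) \<A>" and sub: "\<A> \<subseteq> sets P"
    and E: "E \<in> sigma_sets (space P) \<A>"
    and ge: "\<And>A. A \<in> \<A> \<Longrightarrow> (c::real) \<le> measure P A + measure Q (space P - A)"
  shows "c \<le> measure P E + measure Q (space P - E)"
proof (rule field_le_epsilon)
  fix \<epsilon> :: real assume e: "\<epsilon> > 0"
  interpret P: prob_space P by (rule P)
  interpret Q: prob_space Q by (rule Q)
  note [simp] = PQ
  obtain A where A: "A \<in> \<A>" "measure P (sym_diff E A) + measure Q (sym_diff E A) < \<epsilon>"
    using approximable_by_algebra[OF P.finite_measure_axioms Q.finite_measure_axioms PQ alg sub E e] by auto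
  have Em: "E \<in> sets P" using E sub sets.sigma_sets_subset by blast
  have Am: "A \<in> sets P" using A sub by auto
  have "measure P A \<le> measure P (E \<union> sym_diff E A)"
    using Em Am by (intro P.finite_measure_mono) auto
  also have "\<dots> \<le> measure P E + measure P (sym_diff E A)"
    using Em Am by (intro measure_Un_le) auto
  finally have 1: "measure P A \<le> measure P E + measure P (sym_diff E A)" .
  have "measure Q (space P - A) \<le> measure Q ((space P - E) \<union> sym_diff E A)"
    using Em Am by (intro Q.finite_measure_mono) auto
  also have "\<dots> \<le> measure Q (space P - E) + measure Q (sym_diff E A)"
    using Em Am by (intro measure_Un_le) auto
  finally show "c \<le> measure P E + measure Q (space P - E) + \<epsilon>" using 1 A ge[OF A(1)] by linarith
qed

section \<open>Events determined by finitely many counts\<close>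

lemma generators_point_space:
  "{{\<mu> \<in> point_measures. emeasure \<mu> A \<in> B} | A B. A \<in> sets unit_interval \<and> B \<in> sets borel} \<subseteq> Pow point_measures"
  by auto

lemma space_point_space: "space point_space = point_measures"
  unfolding point_space_def by (rule space_measure_of[OF generators_point_space])

lemma measurable_count [measurable]:
  assumes "A \<in> sets unit_interval"
  shows "(\<lambda>\<mu>. emeasure \<mu> A) \<in> borel_measurable point_space"
proof (rule measurableI)
  fix B :: "ennreal set" assume "B \<in> sets borel"
  then have "{\<mu> \<in> point_measures. emeasure \<mu> A \<in> B} \<in> sets point_space"
    unfolding point_space_def sets_measure_of[OF generators_point_space] using assms by blast
  moreover have "(\<lambda>\<mu>. emeasure \<mu> A) -` B \<inter> space point_space = {\<mu> \<in> point_measures. emeasure \<mu> A \<in> B}"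
    by (auto simp: space_point_space)
  ultimately show "(\<lambda>\<mu>. emeasure \<mu> A) -` B \<inter> space point_space \<in> sets point_space" by simp
qed auto

abbreviation sample_space :: "nat \<Rightarrow> (nat \<Rightarrow> real measure) measure" where
  "sample_space n \<equiv> PiM {1..n} (\<lambda>_. point_space)"

text \<open>An event is determined by the counts on \<open>G\<close> if it contains, with a sample, every other sample
  having the same counts. In this form closure under complement is symmetry, and closure under union is
  merging the families.\<close>

definition count_algebra :: "nat \<Rightarrow> (nat \<Rightarrow> real measure) set set" where
  "count_algebra n = {E \<in> sets (sample_space n). \<exists>G. finite G \<and> G \<subseteq> sets unit_interval \<and>
     (\<forall>\<omega>\<in>E. \<forall>\<omega>'\<in>space (sample_space n).
        (\<forall>i\<in>{1..n}. \<forall>A\<in>G. emeasure (\<omega> i) A = emeasure (\<omega>' i) A) \<longrightarrow> \<omega>' \<in> E)}"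

lemma count_algebraE:
  assumes "E \<in> count_algebra n"
  obtains G where "finite G" "G \<subseteq> sets unit_interval"
    "\<And>\<omega> \<omega>'. \<omega> \<in> E \<Longrightarrow> \<omega>' \<in> space (sample_space n) \<Longrightarrow>
      (\<And>i A. i \<in> {1..n} \<Longrightarrow> A \<in> G \<Longrightarrow> emeasure (\<omega> i) A = emeasure (\<omega>' i) A) \<Longrightarrow> \<omega>' \<in> E"
  using assms unfolding count_algebra_def mem_Collect_eq by metis

lemma count_algebraI:
  assumes "E \<in> sets (sample_space n)" "finite G" "G \<subseteq> sets unit_interval"
    "\<And>\<omega> \<omega>'. \<omega> \<in> E \<Longrightarrow> \<omega>' \<in> space (sample_space n) \<Longrightarrow>
      (\<And>i A. i \<in> {1..n} \<Longrightarrow> A \<in> G \<Longrightarrow> emeasure (\<omega> i) A = emeasure (\<omega>' i) A) \<Longrightarrow> \<omega>' \<in> E"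
  shows "E \<in> count_algebra n"
  unfolding count_algebra_def mem_Collect_eq using assms by metis

lemma count_algebra_sets: "E \<in> count_algebra n \<Longrightarrow> E \<in> sets (sample_space n)"
  by (simp add: count_algebra_def)

lemma algebra_count_algebra: "algebra (space (sample_space n)) (count_algebra n)"
  unfolding algebra_iff_Un
proof (intro conjI ballI)
  show "count_algebra n \<subseteq> Pow (space (sample_space n))"
    using sets.sets_into_space count_algebra_sets by blast
  show "{} \<in> count_algebra n" by (rule count_algebraI[of _ _ "{}"]) auto
next
  fix E assume E: "E \<in> count_algebra n"
  then obtain G where G: "finite G" "G \<subseteq> sets unit_interval"
    "\<And>\<omega> \<omega>'. \<omega> \<in> E \<Longrightarrow> \<omega>' \<in> space (sample_space n) \<Longrightarrow>
      (\<And>i A. i \<in> {1..n} \<Longrightarrow> A \<in> G \<Longrightarrow> emeasure (\<omega> i) A = emeasure (\<omega>' i) A) \<Longrightarrow> \<omega>' \<in> E"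
    by (rule count_algebraE) blast
  show "space (sample_space n) - E \<in> count_algebra n"
  proof (rule count_algebraI[OF _ G(1,2)])
    show "space (sample_space n) - E \<in> sets (sample_space n)"
      by (intro sets.compl_sets count_algebra_sets E)
    fix \<omega> \<omega>'
    assume w: "\<omega> \<in> space (sample_space n) - E" "\<omega>' \<in> space (sample_space n)"
      and eq: "\<And>i A. i \<in> {1..n} \<Longrightarrow> A \<in> G \<Longrightarrow> emeasure (\<omega> i) A = emeasure (\<omega>' i) A"
    show "\<omega>' \<in> space (sample_space n) - E"
    proof (rule DiffI[OF w(2) notI])
      assume "\<omega>' \<in> E"
      from G(3)[OF this _ eq[symmetric]] w(1) show False by simp
    qed
  qed
next
  fix E E' assume E: "E \<in> count_algebra n" and E': "E' \<in> count_algebra n"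
  from E obtain G where G: "finite G" "G \<subseteq> sets unit_interval"
    "\<And>\<omega> \<omega>'. \<omega> \<in> E \<Longrightarrow> \<omega>' \<in> space (sample_space n) \<Longrightarrow>
      (\<And>i A. i \<in> {1..n} \<Longrightarrow> A \<in> G \<Longrightarrow> emeasure (\<omega> i) A = emeasure (\<omega>' i) A) \<Longrightarrow> \<omega>' \<in> E"
    by (rule count_algebraE) blast
  from E' obtain G' where G': "finite G'" "G' \<subseteq> sets unit_interval"
    "\<And>\<omega> \<omega>'. \<omega> \<in> E' \<Longrightarrow> \<omega>' \<in> space (sample_space n) \<Longrightarrow>
      (\<And>i A. i \<in> {1..n} \<Longrightarrow> A \<in> G' \<Longrightarrow> emeasure (\<omega> i) A = emeasure (\<omega>' i) A) \<Longrightarrow> \<omega>' \<in> E'"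
    by (rule count_algebraE) blast
  show "E \<union> E' \<in> count_algebra n"
  proof (rule count_algebraI[of _ _ "G \<union> G'"])
    show "E \<union> E' \<in> sets (sample_space n)" using E E' by (intro sets.Un count_algebra_sets)
    fix \<omega> \<omega>'
    assume "\<omega> \<in> E \<union> E'" and w': "\<omega>' \<in> space (sample_space n)"
      and eq: "\<And>i A. i \<in> {1..n} \<Longrightarrow> A \<in> G \<union> G' \<Longrightarrow> emeasure (\<omega> i) A = emeasure (\<omega>' i) A"
    then consider "\<omega> \<in> E" | "\<omega> \<in> E'" by blast
    then show "\<omega>' \<in> E \<union> E'"
    proof cases
      case 1
      from G(3)[OF this w' eq] show ?thesis by simp
    next
      case 2
      from G'(3)[OF this w' eq] show ?thesis by simp
    qed
  qed (use G G' in auto)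
qed

text \<open>The algebra contains all events \<open>{\<omega>. emeasure (\<omega> i) A \<in> B}\<close>, so the coordinates of a sample are
  measurable for the \<open>\<sigma>\<close>-algebra it generates, and with them the identity map into the product space.\<close>

lemma sets_sample_space_generated:
  assumes E: "E \<in> sets (sample_space n)"
  shows "E \<in> sigma_sets (space (sample_space n)) (count_algebra n)"
proof -
  interpret algebra "space (sample_space n)" "count_algebra n" by (rule algebra_count_algebra)
  let ?S = "sigma (space (sample_space n)) (count_algebra n)"
  have sub: "count_algebra n \<subseteq> Pow (space (sample_space n))" by (rule space_closed)
  have sp: "space ?S = space (sample_space n)" and se: "sets ?S = sigma_sets (space (sample_space n)) (count_algebra n)"
    using sub by (auto simp: sets_measure_of space_measure_of)
  have "(\<lambda>\<omega>. \<omega>) \<in> measurable ?S (sample_space n)"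
  proof (rule measurable_PiM_single'[where f = "\<lambda>i \<omega>. \<omega> i"])
    fix i assume i: "i \<in> {1..n}"
    have "(\<lambda>\<omega>. \<omega> i) \<in> measurable ?S (sigma point_measures
        {{\<mu> \<in> point_measures. emeasure \<mu> A \<in> B} | A B. A \<in> sets unit_interval \<and> B \<in> sets borel})"
    proof (rule measurable_measure_of[OF generators_point_space])
      show "(\<lambda>\<omega>. \<omega> i) \<in> space ?S \<rightarrow> point_measures"
        using i unfolding sp by (auto simp: space_PiM space_point_space PiE_iff)
      fix Y assume "Y \<in> {{\<mu> \<in> point_measures. emeasure \<mu> A \<in> B} | A B. A \<in> sets unit_interval \<and> B \<in> sets borel}"
      then obtain A B where Y: "Y = {\<mu> \<in> point_measures. emeasure \<mu> A \<in> B}"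
        and A: "A \<in> sets unit_interval" and B: "B \<in> sets borel" by auto
      have eq: "(\<lambda>\<omega>. \<omega> i) -` Y \<inter> space ?S = {\<omega> \<in> space (sample_space n). emeasure (\<omega> i) A \<in> B}"
      proof -
        have "\<omega> i \<in> point_measures" if "\<omega> \<in> space (sample_space n)" for \<omega>
          using that i by (auto simp: space_PiM space_point_space PiE_iff)
        then show ?thesis unfolding sp Y by blast
      qed
      have "(\<lambda>\<omega>. emeasure (\<omega> i) A) \<in> borel_measurable (sample_space n)"
        using measurable_compose[OF measurable_component_singleton[OF i] measurable_count[OF A]] .
      then have "{\<omega> \<in> space (sample_space n). emeasure (\<omega> i) A \<in> B} \<in> sets (sample_space n)"
        using B by measurable
      then have "{\<omega> \<in> space (sample_space n). emeasure (\<omega> i) A \<in> B} \<in> count_algebra n"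
        by (rule count_algebraI[of _ _ "{A}"]) (use A i in auto)
      then show "(\<lambda>\<omega>. \<omega> i) -` Y \<inter> space ?S \<in> sets ?S"
        unfolding eq se by (rule sigma_sets.Basic)
    qed
    then show "(\<lambda>\<omega>. \<omega> i) \<in> measurable ?S point_space"
      by (simp only: point_space_def[symmetric])
  next
    show "(\<lambda>\<omega>. \<omega>) \<in> space ?S \<rightarrow> {1..n} \<rightarrow>\<^sub>E space point_space"
      unfolding sp by (simp add: space_PiM)
  qed
  from measurable_sets[OF this E] show ?thesis
    unfolding se sp using sets.sets_into_space[OF E] by (simp add: Int_absorb2)
qed

text \<open>The cells are the classes of points lying in the same members of \<open>G\<close>.\<close>

lemma finite_partition_refining:
  assumes G: "finite G" "G \<subseteq> sets M" and ne: "space M \<noteq> {}"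
  obtains F where "finite F" "F \<subseteq> sets M" "disjoint F" "\<Union>F = space M" "F \<noteq> {}"
    "\<And>A. A \<in> G \<Longrightarrow> \<exists>H\<subseteq>F. A = \<Union>H"
proof -
  define cell where "cell x = {y \<in> space M. \<forall>A\<in>G. y \<in> A \<longleftrightarrow> x \<in> A}" for x
  define F where "F = cell ` space M"
  show thesis
  proof (rule that)
    have "cell x = (\<lambda>H. {y \<in> space M. \<forall>A\<in>G. y \<in> A \<longleftrightarrow> A \<in> H}) {A \<in> G. x \<in> A}" for x
      by (auto simp: cell_def)
    then have "F \<subseteq> (\<lambda>H. {y \<in> space M. \<forall>A\<in>G. y \<in> A \<longleftrightarrow> A \<in> H}) ` Pow G"
      unfolding F_def by blast
    then show "finite F" using G(1) by (meson finite_Pow_iff finite_imageI finite_subset)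
    have "cell x \<in> sets M" for x
      unfolding cell_def
    proof (rule sets.sets_Collect_finite_All[OF _ G(1)])
      fix A assume A: "A \<in> G"
      have "{y \<in> space M. y \<in> A \<longleftrightarrow> x \<in> A} = (if x \<in> A then A else space M - A)"
        using A G(2) sets.sets_into_space by (auto split: if_splits)
      then show "{y \<in> space M. y \<in> A \<longleftrightarrow> x \<in> A} \<in> sets M" using A G(2) by auto
    qed
    then show "F \<subseteq> sets M" by (auto simp: F_def)
    show "disjoint F" by (auto simp: F_def cell_def disjoint_def)
    show "\<Union>F = space M" by (auto simp: F_def cell_def)
    show "F \<noteq> {}" using ne by (auto simp: F_def)
    fix A assume A: "A \<in> G"
    then have "A \<subseteq> space M" using G(2) sets.sets_into_space by auto
    then have "A = \<Union>(cell ` A)" "cell ` A \<subseteq> F" using A by (auto simp: F_def cell_def)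
    then show "\<exists>H\<subseteq>F. A = \<Union>H" by metis
  qed
qed

section \<open>Affinity of Poisson samples\<close>

definition poisson_weight :: "real \<Rightarrow> nat \<Rightarrow> real" where
  "poisson_weight a k = exp (- a) * a ^ k / fact k"

text \<open>After extracting \<open>exp (- (a + b) / 2)\<close> the terms are those of the exponential series of
  \<open>sqrt (a * b)\<close>.\<close>

lemma poisson_weight_affinity:
  assumes a: "a \<ge> 0" and b: "b \<ge> 0"
  shows "(\<lambda>K. \<Sum>k\<le>K. sqrt (poisson_weight a k * poisson_weight b k)) \<longlonglongrightarrow> exp (- ((sqrt a - sqrt b)\<^sup>2 / 2))"
proof -
  have weight: "sqrt (poisson_weight a k * poisson_weight b k) = exp (- ((a + b) / 2)) * (sqrt (a * b) ^ k /\<^sub>R fact k)" for k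
  proof (rule real_sqrt_unique)
    have square: "(e * (r /\<^sub>R z))\<^sup>2 = e\<^sup>2 * r\<^sup>2 / (z * z)" for e r z :: real
      by (simp add: power2_eq_square field_simps)
    have "(sqrt (a * b) ^ k)\<^sup>2 = (a * b) ^ k"
      using a b by (simp add: power2_eq_square flip: power_mult_distrib)
    moreover have "(exp (- ((a + b) / 2)))\<^sup>2 = exp (- a) * exp (- b)"
      by (simp add: power2_eq_square flip: exp_add)
    ultimately show "(exp (- ((a + b) / 2)) * (sqrt (a * b) ^ k /\<^sub>R fact k))\<^sup>2 = poisson_weight a k * poisson_weight b k"
      unfolding square poisson_weight_def by (simp add: power_mult_distrib)
  qed (use a b in auto)
  have "(\<lambda>k. exp (- ((a + b) / 2)) * (sqrt (a * b) ^ k /\<^sub>R fact k)) sums (exp (- ((a + b) / 2)) * exp (sqrt (a * b)))"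
    by (intro sums_mult exp_converges)
  also have "exp (- ((a + b) / 2)) * exp (sqrt (a * b)) = exp (- ((sqrt a - sqrt b)\<^sup>2 / 2))"
    using a b by (simp add: power2_diff real_sqrt_mult diff_divide_distrib add_divide_distrib flip: exp_add)
  finally show ?thesis unfolding weight sums_def_le .
qed

lemma poisson_law_prob_space: "poisson_law f P \<Longrightarrow> prob_space P"
  and poisson_law_sets: "poisson_law f P \<Longrightarrow> sets P = sets point_space"
  by (auto simp: poisson_law_def poisson_point_process_def)

lemma poisson_law_joint_counts:
  assumes P: "poisson_law f P" and F: "finite F" "F \<subseteq> sets unit_interval" "disjoint F" "F \<noteq> {}"
  shows "measure P {\<mu> \<in> space P. \<forall>A\<in>F. emeasure \<mu> A = of_nat (\<kappa> A)}
    = (\<Prod>A\<in>F. poisson_weight (set_lebesgue_integral unit_interval A f) (\<kappa> A))"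
proof -
  interpret prob_space P by (rule poisson_law_prob_space[OF P])
  have ind: "indep_vars (\<lambda>_. borel) (\<lambda>A \<mu>. emeasure \<mu> A) F"
    using P F by (auto simp: poisson_law_def poisson_point_process_def)
  have count: "measure P {\<mu> \<in> space P. emeasure \<mu> A = of_nat k}
      = poisson_weight (set_lebesgue_integral unit_interval A f) k" if "A \<in> F" for A k
    using P F that by (auto simp: poisson_law_def poisson_point_process_def poisson_weight_def)
  have "{\<mu> \<in> space P. \<forall>A\<in>F. emeasure \<mu> A = of_nat (\<kappa> A)}
      = (\<Inter>A\<in>F. (\<lambda>\<mu>. emeasure \<mu> A) -` {of_nat (\<kappa> A)} \<inter> space P)"
    using F(4) by auto
  also have "prob \<dots> = (\<Prod>A\<in>F. prob ((\<lambda>\<mu>. emeasure \<mu> A) -` {of_nat (\<kappa> A)} \<inter> space P))"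
    by (rule indep_varsD[OF ind]) (use F in auto)
  also have "\<dots> = (\<Prod>A\<in>F. poisson_weight (set_lebesgue_integral unit_interval A f) (\<kappa> A))"
    by (intro prod.cong refl) (auto simp: count[symmetric] intro!: arg_cong[where f = prob])
  finally show ?thesis .
qed

lemma sample_joint_counts:
  fixes n :: nat and \<kappa> :: "nat \<times> real set \<Rightarrow> nat"
  assumes P: "poisson_law f P" and F: "finite F" "F \<subseteq> sets unit_interval" "disjoint F" "F \<noteq> {}"
  defines "C \<equiv> {\<omega> \<in> space (sample_space n). \<forall>i\<in>{1..n}. \<forall>A\<in>F. emeasure (\<omega> i) A = of_nat (\<kappa> (i, A))}"
  shows "C \<in> sets (sample_space n)"
    and "measure (PiM {1..n} (\<lambda>_. P)) C
      = (\<Prod>\<iota>\<in>{1..n}\<times>F. poisson_weight (set_lebesgue_integral unit_interval (snd \<iota>) f) (\<kappa> \<iota>))"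
proof -
  interpret prob_space P by (rule poisson_law_prob_space[OF P])
  interpret PP: finite_product_prob_space "\<lambda>_. P" "{1..n}" by unfold_locales auto
  have sP: "sets P = sets point_space" by (rule poisson_law_sets[OF P])
  have spP: "space P = space point_space" by (rule sets_eq_imp_space_eq[OF sP])
  define D where "D i = {\<mu> \<in> space P. \<forall>A\<in>F. emeasure \<mu> A = of_nat (\<kappa> (i, A))}" for i
  have D: "D i \<in> sets P" for i
    unfolding D_def sP spP
  proof (rule sets.sets_Collect_finite_All[OF _ F(1)])
    fix A assume "A \<in> F"
    then have "(\<lambda>\<mu>. emeasure \<mu> A) \<in> borel_measurable point_space" using F(2) measurable_count by auto
    then show "{\<mu> \<in> space point_space. emeasure \<mu> A = of_nat (\<kappa> (i, A))} \<in> sets point_space" by measurable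
  qed
  have C: "C = PiE {1..n} D"
    unfolding C_def D_def space_PiM spP PiE_iff set_eq_iff mem_Collect_eq by blast
  show "C \<in> sets (sample_space n)"
    unfolding C using D by (intro sets_PiM_I_finite) (auto simp: sP)
  have "measure (PiM {1..n} (\<lambda>_. P)) C = (\<Prod>i\<in>{1..n}. prob (D i))"
    unfolding C by (rule PP.prob_times) (use D in auto)
  also have "\<dots> = (\<Prod>i\<in>{1..n}. \<Prod>A\<in>F. poisson_weight (set_lebesgue_integral unit_interval A f) (\<kappa> (i, A)))"
    unfolding D_def by (intro prod.cong refl poisson_law_joint_counts[OF P F])
  also have "\<dots> = (\<Prod>\<iota>\<in>{1..n}\<times>F. poisson_weight (set_lebesgue_integral unit_interval (snd \<iota>) f) (\<kappa> \<iota>))"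
    by (simp add: prod.cartesian_product case_prod_beta)
  finally show "measure (PiM {1..n} (\<lambda>_. P)) C
      = (\<Prod>\<iota>\<in>{1..n}\<times>F. poisson_weight (set_lebesgue_integral unit_interval (snd \<iota>) f) (\<kappa> \<iota>))" .
qed

text \<open>Split the affinity into the cells inside and outside \<open>E\<close> and apply the Cauchy-Schwarz inequality
  to each part: the first is at most \<open>sqrt (P E) * 1\<close>, the second at most \<open>1 * sqrt (Q (- E))\<close>.\<close>

lemma affinity_le_error_roots:
  assumes P: "prob_space P" and Q: "prob_space Q" and PQ: "sets Q = sets P" and E: "E \<in> sets P"
    and B: "finite B" and C: "\<And>\<kappa>. \<kappa> \<in> B \<Longrightarrow> C \<kappa> \<in> sets P" and disj: "disjoint_family_on C B"
    and dec: "\<And>\<kappa>. \<kappa> \<in> B \<Longrightarrow> C \<kappa> \<subseteq> E \<or> C \<kappa> \<inter> E = {}"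
  shows "(\<Sum>\<kappa>\<in>B. sqrt (measure P (C \<kappa>) * measure Q (C \<kappa>)))
    \<le> sqrt (measure P E) + sqrt (measure Q (space P - E))"
proof -
  interpret P: prob_space P by (rule P)
  interpret Q: prob_space Q by (rule Q)
  have CS: "(\<Sum>\<kappa>\<in>B'. sqrt (measure P (C \<kappa>) * measure Q (C \<kappa>)))
      \<le> sqrt (measure P (\<Union>\<kappa>\<in>B'. C \<kappa>)) * sqrt (measure Q (\<Union>\<kappa>\<in>B'. C \<kappa>))" if B': "B' \<subseteq> B" for B'
  proof -
    have fin: "finite B'" using B B' finite_subset by auto
    have dj: "disjoint_family_on C B'" using disj B' by (auto simp: disjoint_family_on_def)
    have "(\<Sum>\<kappa>\<in>B'. sqrt (measure P (C \<kappa>)) * sqrt (measure Q (C \<kappa>)))\<^sup>2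
        \<le> (\<Sum>\<kappa>\<in>B'. (sqrt (measure P (C \<kappa>)))\<^sup>2) * (\<Sum>\<kappa>\<in>B'. (sqrt (measure Q (C \<kappa>)))\<^sup>2)"
      by (rule Cauchy_Schwarz_ineq_sum)
    also have "\<dots> = measure P (\<Union>\<kappa>\<in>B'. C \<kappa>) * measure Q (\<Union>\<kappa>\<in>B'. C \<kappa>)"
    proof -
      have "C ` B' \<subseteq> sets P" "C ` B' \<subseteq> sets Q" using C B' PQ by auto
      then show ?thesis
        using P.finite_measure_finite_Union[OF fin _ dj] Q.finite_measure_finite_Union[OF fin _ dj] by simp
    qed
    finally have "(\<Sum>\<kappa>\<in>B'. sqrt (measure P (C \<kappa>)) * sqrt (measure Q (C \<kappa>)))
        \<le> sqrt (measure P (\<Union>\<kappa>\<in>B'. C \<kappa>) * measure Q (\<Union>\<kappa>\<in>B'. C \<kappa>))"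
      by (rule real_le_rsqrt)
    then show ?thesis by (simp add: real_sqrt_mult)
  qed
  let ?B1 = "{\<kappa>\<in>B. C \<kappa> \<subseteq> E}" and ?B2 = "{\<kappa>\<in>B. \<not> C \<kappa> \<subseteq> E}"
  have "(\<Sum>\<kappa>\<in>?B1. sqrt (measure P (C \<kappa>) * measure Q (C \<kappa>))) \<le> sqrt (measure P (\<Union>\<kappa>\<in>?B1. C \<kappa>)) * sqrt (measure Q (\<Union>\<kappa>\<in>?B1. C \<kappa>))"
    by (rule CS) auto
  also have "\<dots> \<le> sqrt (measure P E) * 1"
    using E by (intro mult_mono real_sqrt_le_mono P.finite_measure_mono) auto
  finally have 1: "(\<Sum>\<kappa>\<in>?B1. sqrt (measure P (C \<kappa>) * measure Q (C \<kappa>))) \<le> sqrt (measure P E)" by simp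
  have sub: "(\<Union>\<kappa>\<in>?B2. C \<kappa>) \<subseteq> space P - E" using dec C sets.sets_into_space by fast
  have "(\<Sum>\<kappa>\<in>?B2. sqrt (measure P (C \<kappa>) * measure Q (C \<kappa>))) \<le> sqrt (measure P (\<Union>\<kappa>\<in>?B2. C \<kappa>)) * sqrt (measure Q (\<Union>\<kappa>\<in>?B2. C \<kappa>))"
    by (rule CS) auto
  also have "\<dots> \<le> 1 * sqrt (measure Q (space P - E))"
    using E PQ by (intro mult_mono real_sqrt_le_mono Q.finite_measure_mono[OF sub]) auto
  finally have 2: "(\<Sum>\<kappa>\<in>?B2. sqrt (measure P (C \<kappa>) * measure Q (C \<kappa>))) \<le> sqrt (measure Q (space P - E))" by simp
  have "(\<Sum>\<kappa>\<in>B. sqrt (measure P (C \<kappa>) * measure Q (C \<kappa>)))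
     = (\<Sum>\<kappa>\<in>?B1. sqrt (measure P (C \<kappa>) * measure Q (C \<kappa>))) + (\<Sum>\<kappa>\<in>?B2. sqrt (measure P (C \<kappa>) * measure Q (C \<kappa>)))"
    using B by (subst sum.union_disjoint[symmetric]) (auto intro!: sum.cong)
  with 1 2 show ?thesis by linarith
qed

text \<open>With \<open>l\<close> the length of \<open>A\<close>, the means satisfy \<open>\<bar>a - b\<bar> \<le> D * l\<close> and \<open>sqrt a + sqrt b \<ge> 2 * sqrt (m * l)\<close>;
  divide \<open>a - b = (sqrt a - sqrt b) * (sqrt a + sqrt b)\<close>. The bound is additive in \<open>A\<close>, hence its sum over a
  partition does not depend on the partition.\<close>

lemma poisson_mean_gap:
  fixes f g :: "real \<Rightarrow> real"
  assumes f: "integrable unit_interval f" and g: "integrable unit_interval g" and m: "m > 0"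
    and bounds: "\<And>x. x \<in> {0..1} \<Longrightarrow> m \<le> f x \<and> m \<le> g x \<and> \<bar>f x - g x\<bar> \<le> D"
    and A: "A \<in> sets unit_interval"
  defines "a \<equiv> set_lebesgue_integral unit_interval A f" and "b \<equiv> set_lebesgue_integral unit_interval A g"
  shows "a \<ge> 0" "b \<ge> 0" "(sqrt a - sqrt b)\<^sup>2 \<le> D\<^sup>2 / (4 * m) * measure unit_interval A"
proof -
  interpret U: prob_space unit_interval by (rule prob_space_unit_interval)
  define l where "l = measure unit_interval A"
  have Asp: "x \<in> {0..1}" if "x \<in> A" for x
    using sets.sets_into_space[OF A] that by auto
  have int: "set_integrable unit_interval A h" if "integrable unit_interval h" for h :: "real \<Rightarrow> real"
    using integrable_mult_indicator[OF A that] by (simp add: set_integrable_def)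
  have const: "set_lebesgue_integral unit_interval A (\<lambda>_. c) = c * l" for c :: real
    unfolding l_def using U.emeasure_finite A
    by (subst set_integral_const) (auto simp: top_unique)
  have "m * l \<le> a"
    unfolding a_def const[symmetric] using bounds Asp
    by (intro set_integral_mono int f) auto
  moreover have "m * l \<le> b"
    unfolding b_def const[symmetric] using bounds Asp
    by (intro set_integral_mono int g) auto
  moreover have l: "l \<ge> 0" by (simp add: l_def)
  ultimately have ab: "m * l \<le> a" "m * l \<le> b" "a \<ge> 0" "b \<ge> 0"
    using m by (auto intro: order_trans[of 0 "m * l"])
  show "a \<ge> 0" "b \<ge> 0" by fact+
  have diff: "a - b = set_lebesgue_integral unit_interval A (\<lambda>x. f x - g x)"
    unfolding a_def b_def by (intro set_integral_diff(2)[symmetric] int f g)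
  have lower: "- D \<le> f x - g x" if "x \<in> A" for x
    using bounds[OF Asp[OF that]] by linarith
  have "a - b \<le> D * l"
    unfolding diff const[symmetric] using bounds Asp
    by (intro set_integral_mono int Bochner_Integration.integrable_diff f g) (auto simp: abs_le_iff)
  moreover have "- D * l \<le> a - b"
    unfolding diff const[symmetric]
    by (intro set_integral_mono int Bochner_Integration.integrable_diff f g lower) auto
  ultimately have gap: "\<bar>a - b\<bar> \<le> D * l" by (simp add: abs_le_iff)
  show "(sqrt a - sqrt b)\<^sup>2 \<le> D\<^sup>2 / (4 * m) * measure unit_interval A"
  proof (cases "l = 0")
    case True
    with gap show ?thesis by (simp add: l_def[symmetric])
  next
    case False
    with l have lpos: "l > 0" by simp
    have "sqrt (m * l) \<le> sqrt a" "sqrt (m * l) \<le> sqrt b"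
      by (rule real_sqrt_le_mono[OF ab(1)], rule real_sqrt_le_mono[OF ab(2)])
    then have "2 * sqrt (m * l) \<le> sqrt a + sqrt b" by linarith
    then have "(2 * sqrt (m * l))\<^sup>2 \<le> (sqrt a + sqrt b)\<^sup>2"
      by (rule power_mono) (use m l in simp)
    also have "(2 * sqrt (m * l))\<^sup>2 = 4 * m * l" using m l by (simp add: power_mult_distrib)
    finally have "(sqrt a - sqrt b)\<^sup>2 * (4 * m * l) \<le> (sqrt a - sqrt b)\<^sup>2 * (sqrt a + sqrt b)\<^sup>2"
      by (rule mult_left_mono) simp
    also have "\<dots> = (a - b)\<^sup>2"
    proof -
      have "(sqrt a - sqrt b) * (sqrt a + sqrt b) = a - b" using ab by (simp add: algebra_simps)
      then show ?thesis by (simp only: power_mult_distrib[symmetric])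
    qed
    also have "\<dots> \<le> (D * l)\<^sup>2" using gap by (metis abs_ge_zero power2_abs power_mono)
    finally have "(sqrt a - sqrt b)\<^sup>2 * (4 * m) * l \<le> (D\<^sup>2 * l) * l"
      by (simp add: power2_eq_square mult_ac)
    then have "(sqrt a - sqrt b)\<^sup>2 * (4 * m) \<le> D\<^sup>2 * l" using lpos by simp
    then show ?thesis using m unfolding l_def[symmetric] by (simp add: pos_le_divide_eq)
  qed
qed

lemma sqrt_prod: "sqrt (prod h A) = (\<Prod>x\<in>A. sqrt (h x))"
  by (induction A rule: infinite_finite_induct) (auto simp: real_sqrt_mult)

text \<open>Refine the sets defining \<open>E\<close> to a partition \<open>F\<close>. A configuration \<open>\<kappa>\<close> assigns a count to each
  observation and each cell; the events \<open>C \<kappa>\<close> decide \<open>E\<close>, and their probabilities are products of Poisson weights.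
  Truncating all counts at \<open>K\<close> keeps the sums finite, and the affinities are recovered as \<open>K\<close> grows.\<close>

lemma count_algebra_error_sum:
  assumes P: "poisson_law f P" and Q: "poisson_law g Q"
    and f: "integrable unit_interval f" and g: "integrable unit_interval g" and m: "m > 0"
    and bounds: "\<And>x. x \<in> {0..1} \<Longrightarrow> m \<le> f x \<and> m \<le> g x \<and> \<bar>f x - g x\<bar> \<le> D"
    and E: "E \<in> count_algebra n"
  shows "exp (- (real n * D\<^sup>2 / (4 * m))) / 2
    \<le> measure (PiM {1..n} (\<lambda>_. P)) E
      + measure (PiM {1..n} (\<lambda>_. Q)) (space (sample_space n) - E)"
proof -
  let ?P = "PiM {1..n} (\<lambda>_. P)" and ?Q = "PiM {1..n} (\<lambda>_. Q)" and ?\<Omega> = "space (sample_space n)"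
  have setsP: "sets ?P = sets (sample_space n)" and setsQ: "sets ?Q = sets (sample_space n)"
    by (rule sets_PiM_cong[OF refl poisson_law_sets[OF P]], rule sets_PiM_cong[OF refl poisson_law_sets[OF Q]])
  note spP = sets_eq_imp_space_eq[OF setsP]
  have probP: "prob_space ?P" and probQ: "prob_space ?Q"
    by (rule prob_space_PiM, rule poisson_law_prob_space[OF P], rule prob_space_PiM, rule poisson_law_prob_space[OF Q])
  have Em: "E \<in> sets (sample_space n)" using E by (simp add: count_algebra_def)
  obtain G where G: "finite G" "G \<subseteq> sets unit_interval"
     and EG: "\<And>\<omega> \<omega>'. \<omega> \<in> E \<Longrightarrow> \<omega>' \<in> ?\<Omega> \<Longrightarrow>
        (\<And>i A. i \<in> {1..n} \<Longrightarrow> A \<in> G \<Longrightarrow> emeasure (\<omega> i) A = emeasure (\<omega>' i) A) \<Longrightarrow> \<omega>' \<in> E"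
    using E by (rule count_algebraE) blast
  have nonempty: "space unit_interval \<noteq> {}" by simp
  obtain F where
    F: "finite F" "F \<subseteq> sets unit_interval" "disjoint F" "F \<noteq> {}" and
    F_cover: "\<Union>F = space unit_interval" and F_refines: "\<And>A. A \<in> G \<Longrightarrow> \<exists>H\<subseteq>F. A = \<Union>H"
    by (rule finite_partition_refining[OF G nonempty], rule that, assumption+)
  define I where "I = {1..n} \<times> F"
  define a where "a \<iota> = set_lebesgue_integral unit_interval (snd \<iota>) f" for \<iota> :: "nat \<times> real set"
  define b where "b \<iota> = set_lebesgue_integral unit_interval (snd \<iota>) g" for \<iota> :: "nat \<times> real set"
  define C where "C \<kappa> = {\<omega> \<in> ?\<Omega>. \<forall>i\<in>{1..n}. \<forall>A\<in>F. emeasure (\<omega> i) A = of_nat (\<kappa> (i, A))}"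
    for \<kappa> :: "nat \<times> real set \<Rightarrow> nat"
  have C_sets: "C \<kappa> \<in> sets (sample_space n)" for \<kappa>
    unfolding C_def by (rule sample_joint_counts(1)[OF P F, where \<kappa> = \<kappa>])
  have probs: "measure ?P (C \<kappa>) = (\<Prod>\<iota>\<in>I. poisson_weight (a \<iota>) (\<kappa> \<iota>))"
      "measure ?Q (C \<kappa>) = (\<Prod>\<iota>\<in>I. poisson_weight (b \<iota>) (\<kappa> \<iota>))" for \<kappa>
    unfolding C_def I_def a_def b_def
    by (rule sample_joint_counts(2)[OF P F, where \<kappa> = \<kappa>], rule sample_joint_counts(2)[OF Q F, where \<kappa> = \<kappa>])
  have finI: "finite I" unfolding I_def using F by auto
  have gap: "a \<iota> \<ge> 0" "b \<iota> \<ge> 0"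
      "(sqrt (a \<iota>) - sqrt (b \<iota>))\<^sup>2 \<le> D\<^sup>2 / (4 * m) * measure unit_interval (snd \<iota>)" if "\<iota> \<in> I" for \<iota>
  proof -
    have "snd \<iota> \<in> sets unit_interval" using that F(2) by (auto simp: I_def)
    from poisson_mean_gap[OF f g m bounds this]
    show "a \<iota> \<ge> 0" "b \<iota> \<ge> 0"
      "(sqrt (a \<iota>) - sqrt (b \<iota>))\<^sup>2 \<le> D\<^sup>2 / (4 * m) * measure unit_interval (snd \<iota>)"
      unfolding a_def b_def by auto
  qed
  \<comment> \<open>Counts on a member of the original family are sums of counts on the cells it contains.\<close>
  have decided: "C \<kappa> \<subseteq> E \<or> C \<kappa> \<inter> E = {}" for \<kappa>
  proof (rule disjCI)
    assume "C \<kappa> \<inter> E \<noteq> {}"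
    then obtain \<omega> where \<omega>: "\<omega> \<in> C \<kappa>" "\<omega> \<in> E" by auto
    show "C \<kappa> \<subseteq> E"
    proof
      fix \<omega>' assume \<omega>': "\<omega>' \<in> C \<kappa>"
      show "\<omega>' \<in> E"
      proof (rule EG[OF \<omega>(2)])
        show "\<omega>' \<in> ?\<Omega>" using \<omega>' by (simp add: C_def)
        fix i A assume i: "i \<in> {1..n}" and A: "A \<in> G"
        from F_refines[OF A] obtain H where H: "H \<subseteq> F" "A = \<Union>H" by auto
        have dH: "disjoint_family_on (\<lambda>x. x) H"
          using F(3) H(1) by (auto simp: disjoint_family_on_def disjoint_def)
        have add: "emeasure (\<omega> i) A = (\<Sum>X\<in>H. of_nat (\<kappa> (i, X)))" if "\<omega> \<in> C \<kappa>" for \<omega>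
        proof -
          have "sets (\<omega> i) = sets unit_interval"
            using that i by (auto simp: C_def space_PiM space_point_space point_measures_def PiE_iff)
          then have "(\<Sum>X\<in>H. emeasure (\<omega> i) X) = emeasure (\<omega> i) (\<Union>X\<in>H. X)"
            using H F dH by (intro sum_emeasure) (auto intro: finite_subset)
          moreover have "(\<Sum>X\<in>H. emeasure (\<omega> i) X) = (\<Sum>X\<in>H. of_nat (\<kappa> (i, X)))"
            using that i H(1) by (intro sum.cong refl) (auto simp: C_def)
          ultimately show ?thesis using H(2) by simp
        qed
        show "emeasure (\<omega> i) A = emeasure (\<omega>' i) A" using add[OF \<omega>(1)] add[OF \<omega>'] by simp
      qed
    qed
  qed
  have partial: "(\<Prod>\<iota>\<in>I. \<Sum>k\<le>K. sqrt (poisson_weight (a \<iota>) k * poisson_weight (b \<iota>) k))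
      \<le> sqrt (measure ?P E) + sqrt (measure ?Q (?\<Omega> - E))" for K
  proof -
    let ?B = "PiE I (\<lambda>_. {..K})"
    have "(\<Prod>\<iota>\<in>I. \<Sum>k\<le>K. sqrt (poisson_weight (a \<iota>) k * poisson_weight (b \<iota>) k))
        = (\<Sum>\<kappa>\<in>?B. \<Prod>\<iota>\<in>I. sqrt (poisson_weight (a \<iota>) (\<kappa> \<iota>) * poisson_weight (b \<iota>) (\<kappa> \<iota>)))"
      by (rule prod_sum_PiE) (use finI in auto)
    also have "\<dots> = (\<Sum>\<kappa>\<in>?B. sqrt (measure ?P (C \<kappa>) * measure ?Q (C \<kappa>)))"
      by (simp only: probs sqrt_prod prod.distrib[symmetric])
    also have "\<dots> \<le> sqrt (measure ?P E) + sqrt (measure ?Q (space ?P - E))"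
    proof (rule affinity_le_error_roots[OF probP probQ])
      show "disjoint_family_on C ?B"
        unfolding disjoint_family_on_def
      proof (intro ballI impI)
        fix \<kappa> \<kappa>' assume k: "\<kappa> \<in> ?B" "\<kappa>' \<in> ?B" "\<kappa> \<noteq> \<kappa>'"
        then obtain i A where "i \<in> {1..n}" "A \<in> F" "\<kappa> (i, A) \<noteq> \<kappa>' (i, A)"
          unfolding I_def using PiE_ext[of \<kappa> _ _ \<kappa>'] by (metis SigmaE)
        then have "False" if "\<omega> \<in> C \<kappa>" "\<omega> \<in> C \<kappa>'" for \<omega>
          using that unfolding C_def mem_Collect_eq by (metis of_nat_eq_iff)
        then show "C \<kappa> \<inter> C \<kappa>' = {}" by blast
      qed
      show "finite ?B" using finI by (rule finite_PiE) simp
      show "C \<kappa> \<subseteq> E \<or> C \<kappa> \<inter> E = {}" for \<kappa> by (rule decided)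
    qed (simp_all only: setsP setsQ C_sets Em)
    finally show ?thesis by (simp only: spP)
  qed
  have "(\<lambda>K. \<Prod>\<iota>\<in>I. \<Sum>k\<le>K. sqrt (poisson_weight (a \<iota>) k * poisson_weight (b \<iota>) k))
      \<longlonglongrightarrow> (\<Prod>\<iota>\<in>I. exp (- ((sqrt (a \<iota>) - sqrt (b \<iota>))\<^sup>2 / 2)))"
    by (intro tendsto_prod poisson_weight_affinity gap)
  then have "(\<Prod>\<iota>\<in>I. exp (- ((sqrt (a \<iota>) - sqrt (b \<iota>))\<^sup>2 / 2))) \<le> sqrt (measure ?P E) + sqrt (measure ?Q (?\<Omega> - E))"
    by (rule LIMSEQ_le_const2) (intro exI allI impI partial)
  moreover have "(\<Prod>\<iota>\<in>I. exp (- ((sqrt (a \<iota>) - sqrt (b \<iota>))\<^sup>2 / 2))) \<ge> exp (- (real n * D\<^sup>2 / (8 * m)))"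
  proof -
    interpret U: prob_space unit_interval by (rule prob_space_unit_interval)
    have "(\<Sum>A\<in>F. measure unit_interval A) = measure unit_interval (\<Union>A\<in>F. A)"
      using F by (intro U.finite_measure_finite_Union[symmetric]) (auto simp: disjoint_family_on_def disjoint_def)
    also have "\<dots> = 1" using F_cover U.prob_space by simp
    finally have total: "(\<Sum>A\<in>F. measure unit_interval A) = 1" .
    have "(\<Sum>\<iota>\<in>I. (sqrt (a \<iota>) - sqrt (b \<iota>))\<^sup>2 / 2) \<le> (\<Sum>\<iota>\<in>I. D\<^sup>2 / (8 * m) * measure unit_interval (snd \<iota>))"
    proof (rule sum_mono)
      fix \<iota> assume "\<iota> \<in> I"
      from divide_right_mono[OF gap(3)[OF this], of 2]
      show "(sqrt (a \<iota>) - sqrt (b \<iota>))\<^sup>2 / 2 \<le> D\<^sup>2 / (8 * m) * measure unit_interval (snd \<iota>)" by simp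
    qed
    also have "\<dots> = D\<^sup>2 / (8 * m) * (\<Sum>\<iota>\<in>I. measure unit_interval (snd \<iota>))"
      by (simp add: sum_distrib_left)
    also have "(\<Sum>\<iota>\<in>I. measure unit_interval (snd \<iota>)) = (\<Sum>i\<in>{1..n}. \<Sum>A\<in>F. measure unit_interval A)"
      unfolding I_def sum.cartesian_product by (rule sum.cong) auto
    also have "\<dots> = real n" by (simp add: total)
    finally have "(\<Sum>\<iota>\<in>I. (sqrt (a \<iota>) - sqrt (b \<iota>))\<^sup>2 / 2) \<le> D\<^sup>2 / (8 * m) * real n" .
    then have "exp (- (real n * D\<^sup>2 / (8 * m))) \<le> exp (\<Sum>\<iota>\<in>I. - ((sqrt (a \<iota>) - sqrt (b \<iota>))\<^sup>2 / 2))"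
      by (simp add: sum_negf mult.commute)
    then show ?thesis by (simp only: exp_sum[OF finI])
  qed
  ultimately have "exp (- (real n * D\<^sup>2 / (8 * m))) \<le> sqrt (measure ?P E) + sqrt (measure ?Q (?\<Omega> - E))"
    by linarith
  then have "(exp (- (real n * D\<^sup>2 / (8 * m))))\<^sup>2 \<le> (sqrt (measure ?P E) + sqrt (measure ?Q (?\<Omega> - E)))\<^sup>2"
    by (rule power_mono) simp
  \<comment> \<open>\<open>(x + y)\<^sup>2 \<le> 2 * (x\<^sup>2 + y\<^sup>2)\<close>, the difference being \<open>(x - y)\<^sup>2\<close>.\<close>
  also have "\<dots> \<le> (sqrt (measure ?P E) + sqrt (measure ?Q (?\<Omega> - E)))\<^sup>2 + (sqrt (measure ?P E) - sqrt (measure ?Q (?\<Omega> - E)))\<^sup>2"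
    by simp
  also have "\<dots> = 2 * (measure ?P E + measure ?Q (?\<Omega> - E))"
    unfolding power2_sum power2_diff by (simp add: algebra_simps)
  also have "(exp (- (real n * D\<^sup>2 / (8 * m))))\<^sup>2 = exp (- (real n * D\<^sup>2 / (4 * m)))"
  proof -
    have "2 * (real n * D\<^sup>2 / (8 * m)) = real n * D\<^sup>2 / (4 * m)" by simp
    then show ?thesis by (simp add: exp_double[symmetric])
  qed
  finally show ?thesis by simp
qed

text \<open>Le Cam's two-point bound for Poisson samples: no test separates \<open>f\<close> from \<open>g\<close> when \<open>n * D\<^sup>2 / m\<close> stays
  bounded.\<close>

lemma poisson_sample_error_sum:
  assumes P: "poisson_law f P" and Q: "poisson_law g Q"
    and f: "integrable unit_interval f" and g: "integrable unit_interval g" and m: "m > 0"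
    and bounds: "\<And>x. x \<in> {0..1} \<Longrightarrow> m \<le> f x \<and> m \<le> g x \<and> \<bar>f x - g x\<bar> \<le> D"
    and E: "E \<in> sets (sample_space n)"
  shows "exp (- (real n * D\<^sup>2 / (4 * m))) / 2
    \<le> measure (PiM {1..n} (\<lambda>_. P)) E
      + measure (PiM {1..n} (\<lambda>_. Q)) (space (sample_space n) - E)"
proof -
  have setsP: "sets (PiM {1..n} (\<lambda>_. P)) = sets (sample_space n)"
    and setsQ: "sets (PiM {1..n} (\<lambda>_. Q)) = sets (sample_space n)"
    by (rule sets_PiM_cong[OF refl poisson_law_sets[OF P]], rule sets_PiM_cong[OF refl poisson_law_sets[OF Q]])
  note spP = sets_eq_imp_space_eq[OF setsP]
  have probP: "prob_space (PiM {1..n} (\<lambda>_. P))" and probQ: "prob_space (PiM {1..n} (\<lambda>_. Q))"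
    by (rule prob_space_PiM, rule poisson_law_prob_space[OF P], rule prob_space_PiM, rule poisson_law_prob_space[OF Q])
  show ?thesis
    unfolding spP[symmetric]
  proof (rule error_sum_ge_from_algebra[OF probP probQ])
    show "algebra (space (PiM {1..n} (\<lambda>_. P))) (count_algebra n)"
      unfolding spP by (rule algebra_count_algebra)
    show "E \<in> sigma_sets (space (PiM {1..n} (\<lambda>_. P))) (count_algebra n)"
      unfolding spP by (rule sets_sample_space_generated[OF E])
    show "exp (- (real n * D\<^sup>2 / (4 * m))) / 2 \<le> measure (PiM {1..n} (\<lambda>_. P)) A
        + measure (PiM {1..n} (\<lambda>_. Q)) (space (PiM {1..n} (\<lambda>_. P)) - A)" if "A \<in> count_algebra n" for A
      unfolding spP by (rule count_algebra_error_sum[OF P Q f g m bounds that])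
    show "count_algebra n \<subseteq> sets (PiM {1..n} (\<lambda>_. P))"
      unfolding setsP using count_algebra_sets by blast
  qed (simp only: setsP setsQ)
qed

section \<open>A cube of intensities\<close>

lemma integrable_trig_basis: "integrable unit_interval (trig_basis j)"
  by (rule integrable_unit_interval_bounded[OF measurable_trig_basis_unit trig_basis_bound])

definition trig_polynomial :: "nat \<Rightarrow> (int \<Rightarrow> real) \<Rightarrow> real \<Rightarrow> real" where
  "trig_polynomial k c t = (\<Sum>j\<in>{- int k..int k}. c j * trig_basis j t)"

lemma integrable_trig_polynomial: "integrable unit_interval (trig_polynomial k c)"
  unfolding trig_polynomial_def[abs_def]
  by (intro Bochner_Integration.integrable_sum integrable_mult_right integrable_trig_basis)

lemma trig_polynomial_l2: "trig_polynomial k c \<in> l2_space"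
  using trig_polynomial_norm(1)[of "{- int k..int k}" c] integrable_trig_polynomial[of k c]
  by (auto simp: l2_space_def trig_polynomial_def)

lemma fourier_coeff_trig_polynomial:
  "fourier_coeff (trig_polynomial k c) j = (if j \<in> {- int k..int k} then c j else 0)"
proof -
  have eq: "trig_polynomial k c t * trig_basis j t
      = (\<Sum>i\<in>{- int k..int k}. c i * (trig_basis i t * trig_basis j t))" for t
    by (simp add: trig_polynomial_def sum_distrib_right mult.assoc)
  have "fourier_coeff (trig_polynomial k c) j
      = (\<Sum>i\<in>{- int k..int k}. c i * (if i = j then 1 else 0))"
    unfolding fourier_coeff_def eq
    by (simp add: Bochner_Integration.integral_sum integrable_trig_basis_prod trig_basis_orthonormal)
  also have "\<dots> = (\<Sum>i\<in>{- int k..int k}. if i = j then c i else 0)"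
    by (intro sum.cong) auto
  also have "\<dots> = (if j \<in> {- int k..int k} then c j else 0)" by (subst sum.delta) auto
  finally show ?thesis .
qed

text \<open>The subsets \<open>S\<close> of \<open>{- k..k}\<close> are the vertices of the cube: \<open>S\<close> collects the indices with positive sign.
  As the basis function of index 0 is constant, the centre \<open>b\<close> only enters the coefficient of index 0.\<close>

definition vertex_coeff :: "real \<Rightarrow> real \<Rightarrow> int set \<Rightarrow> int \<Rightarrow> real" where
  "vertex_coeff b a S j = (if j = 0 then b else 0) + (if j \<in> S then a else - a)"

definition vertex_intensity :: "real \<Rightarrow> real \<Rightarrow> nat \<Rightarrow> int set \<Rightarrow> real \<Rightarrow> real" where
  "vertex_intensity b a k S = trig_polynomial k (vertex_coeff b a S)"

lemma vertex_intensity_deviation: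
  assumes "a \<ge> 0"
  shows "\<bar>vertex_intensity b a k S t - b\<bar> \<le> a * sqrt 2 * (2 * real k + 1)"
proof -
  let ?J = "{- int k..int k}"
  have split: "vertex_coeff b a S j * trig_basis j t
      = (if j = 0 then b else 0) + (if j \<in> S then a else - a) * trig_basis j t" for j
    by (simp add: vertex_coeff_def distrib_right trig_basis_def)
  have "vertex_intensity b a k S t - b = (\<Sum>j\<in>?J. (if j \<in> S then a else - a) * trig_basis j t)"
    unfolding vertex_intensity_def trig_polynomial_def split sum.distrib by (subst sum.delta) auto
  also have "\<bar>\<dots>\<bar> \<le> (\<Sum>j\<in>?J. \<bar>(if j \<in> S then a else - a) * trig_basis j t\<bar>)" by (rule sum_abs)
  also have "\<dots> \<le> (\<Sum>j\<in>?J. a * sqrt 2)"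
    using assms by (intro sum_mono) (auto simp: abs_mult intro!: mult_left_mono trig_basis_bound)
  also have "\<dots> = a * sqrt 2 * (2 * real k + 1)" by simp
  finally show ?thesis .
qed

lemma vertex_intensity_flip:
  assumes "j \<in> {- int k..int k}" "j \<notin> S"
  shows "vertex_intensity b a k (insert j S) t - vertex_intensity b a k S t = 2 * a * trig_basis j t"
proof -
  have "vertex_intensity b a k (insert j S) t - vertex_intensity b a k S t
      = (\<Sum>i\<in>{- int k..int k}. if i = j then 2 * a * trig_basis i t else 0)"
    unfolding vertex_intensity_def trig_polynomial_def sum_subtractf[symmetric]
    using assms by (intro sum.cong refl) (auto simp: vertex_coeff_def algebra_simps)
  also have "\<dots> = 2 * a * trig_basis j t" using assms by (subst sum.delta) auto
  finally show ?thesis .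
qed

lemma weight_le:
  assumes w: "weight_sequence \<gamma>" and j: "j \<in> {- int k..int k}"
  shows "\<gamma> j \<le> \<gamma> (int k)"
proof -
  have mono: "mono (\<lambda>n::nat. \<gamma> (int n))" and sym: "\<And>j. \<gamma> (- j) = \<gamma> j"
    using w by (auto simp: weight_sequence_def)
  have "\<gamma> j = \<gamma> (int (nat \<bar>j\<bar>))" using sym[of j] by (auto simp: abs_if)
  also have "\<dots> \<le> \<gamma> (int k)" using j by (intro monoD[OF mono]) auto
  finally show ?thesis .
qed

text \<open>The deviation bound keeps the intensity nonnegative. In the ellipsoid condition the centre and
  the perturbation use up at most \<open>L\<^sup>2 / 2\<close> each, by \<open>(u + v)\<^sup>2 \<le> 2 * u\<^sup>2 + 2 * v\<^sup>2\<close> and monotonicity of the weights.\<close>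

lemma vertex_intensity_in_class:
  assumes w: "weight_sequence \<gamma>" and L: "L > 0" and a: "a \<ge> 0"
    and dev: "a * sqrt 2 * (2 * real k + 1) \<le> L / 2"
    and smooth: "a\<^sup>2 * (2 * real k + 1) * (\<gamma> (int k))\<^sup>2 \<le> L\<^sup>2 / 4"
  shows "vertex_intensity (L / 2) a k S \<in> intensity_class \<gamma> L"
proof -
  let ?J = "{- int k..int k}" and ?f = "vertex_intensity (L / 2) a k S"
  have pos: "\<gamma> j > 0" and g0: "\<gamma> 0 = 1" for j using w by (auto simp: weight_sequence_def)
  have coeff: "fourier_coeff ?f j = (if j \<in> ?J then vertex_coeff (L / 2) a S j else 0)" for j
    unfolding vertex_intensity_def by (rule fourier_coeff_trig_polynomial)
  have nonneg: "0 \<le> ?f t" for t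
    using vertex_intensity_deviation[OF a, of "L / 2" k S t] dev by linarith
  let ?h = "\<lambda>j. (\<gamma> j)\<^sup>2 * (fourier_coeff ?f j)\<^sup>2"
  have "(?h has_sum sum ?h ?J) UNIV"
    by (rule has_sum_finite_neutralI[of ?J]) (auto simp: coeff)
  then have summable: "?h summable_on UNIV" and inf: "infsum ?h UNIV = sum ?h ?J"
    by (auto simp: has_sum_imp_summable infsumI)
  have "sum ?h ?J \<le> (\<Sum>j\<in>?J. (if j = 0 then L\<^sup>2 / 2 else 0) + 2 * (\<gamma> (int k))\<^sup>2 * a\<^sup>2)"
  proof (rule sum_mono)
    fix j assume j: "j \<in> ?J"
    define u where "u = (if j = 0 then L / 2 else 0)"
    define v where "v = (if j \<in> S then a else - a)"
    have "(u + v)\<^sup>2 + (u - v)\<^sup>2 = 2 * u\<^sup>2 + 2 * v\<^sup>2" by (simp add: power2_eq_square algebra_simps)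
    then have "(u + v)\<^sup>2 \<le> 2 * u\<^sup>2 + 2 * v\<^sup>2" using zero_le_power2[of "u - v"] by linarith
    then have "?h j \<le> (\<gamma> j)\<^sup>2 * (2 * u\<^sup>2 + 2 * a\<^sup>2)"
      using j by (intro mult_left_mono) (auto simp: coeff vertex_coeff_def u_def v_def split: if_splits)
    also have "\<dots> = (if j = 0 then L\<^sup>2 / 2 else 0) + 2 * (\<gamma> j)\<^sup>2 * a\<^sup>2"
      by (simp add: u_def g0 algebra_simps power2_eq_square)
    also have "\<dots> \<le> (if j = 0 then L\<^sup>2 / 2 else 0) + 2 * (\<gamma> (int k))\<^sup>2 * a\<^sup>2"
      using weight_le[OF w j] pos[of j] by (intro add_left_mono mult_right_mono mult_left_mono power_mono) auto
    finally show "?h j \<le> (if j = 0 then L\<^sup>2 / 2 else 0) + 2 * (\<gamma> (int k))\<^sup>2 * a\<^sup>2" .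
  qed
  also have "\<dots> = L\<^sup>2 / 2 + 2 * (a\<^sup>2 * (2 * real k + 1) * (\<gamma> (int k))\<^sup>2)"
    unfolding sum.distrib by (subst sum.delta) (auto simp: mult_ac)
  also have "\<dots> \<le> L\<^sup>2" using smooth by simp
  finally show ?thesis
    using nonneg summable inf trig_polynomial_l2 by (auto simp: intensity_class_def vertex_intensity_def)
qed

section \<open>Assouad's lemma\<close>

text \<open>An estimator is read as a test for each sign, by comparing its coefficient with the midpoint \<open>c j\<close>
  of the two candidates. The events for \<open>S\<close> and \<open>insert j S\<close> are complementary.\<close>

definition coordinate_error ::
    "nat \<Rightarrow> ((nat \<Rightarrow> real measure) \<Rightarrow> real \<Rightarrow> real) \<Rightarrow> (int \<Rightarrow> real) \<Rightarrow> int set \<Rightarrow> int \<Rightarrow> (nat \<Rightarrow> real measure) set" where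
  "coordinate_error n T c S j = {N \<in> space (sample_space n).
     if j \<in> S then fourier_coeff (T N) j < c j else c j \<le> fourier_coeff (T N) j}"

lemma coordinate_error_sets:
  assumes T: "T \<in> estimators n"
  shows "coordinate_error n T c S j \<in> sets (sample_space n)"
proof -
  have "(\<lambda>N. fourier_coeff (T N) j) \<in> borel_measurable (sample_space n)"
    using measurable_compose[OF _ measurable_fourier_coeff] T by (auto simp: estimators_def)
  then show ?thesis unfolding coordinate_error_def by (cases "j \<in> S") auto
qed

text \<open>A wrong sign in coordinate \<open>j\<close> puts the estimated coefficient beyond the midpoint, at distance at
  least \<open>a\<close> from the true one; Bessel's inequality sums these errors.\<close>

lemma risk_ge_coordinate_errors:
  assumes T: "T \<in> estimators n" and f: "f \<in> l2_space" and P: "poisson_law f P" and J: "finite J"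
    and a: "a \<ge> 0"
    and coeff: "\<And>j. j \<in> J \<Longrightarrow> fourier_coeff f j = c j + (if j \<in> S then a else - a)"
  shows "ennreal (a\<^sup>2 * (\<Sum>j\<in>J. measure (PiM {1..n} (\<lambda>_. P)) (coordinate_error n T c S j)))
    \<le> risk n P T f"
proof -
  let ?P = "PiM {1..n} (\<lambda>_. P)" and ?e = "coordinate_error n T c S"
  have setsP: "sets ?P = sets (sample_space n)"
    using P by (auto intro!: sets_PiM_cong poisson_law_sets)
  note spP = sets_eq_imp_space_eq[OF setsP]
  interpret P: prob_space ?P
    using P by (auto intro!: prob_space_PiM poisson_law_prob_space)
  have em: "?e j \<in> sets ?P" for j using coordinate_error_sets[OF T] setsP by auto
  have "ennreal (a\<^sup>2 * (\<Sum>j\<in>J. measure ?P (?e j))) = (\<Sum>j\<in>J. ennreal (a\<^sup>2) * emeasure ?P (?e j))"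
  proof -
    have each: "ennreal (a\<^sup>2) * emeasure ?P (?e j) = ennreal (a\<^sup>2 * measure ?P (?e j))" for j
      unfolding P.emeasure_eq_measure by (rule ennreal_mult'[symmetric]) simp
    show ?thesis
      unfolding each sum_distrib_left by (rule sum_ennreal[symmetric]) simp
  qed
  also have "\<dots> = (\<integral>\<^sup>+N. (\<Sum>j\<in>J. ennreal (a\<^sup>2) * indicator (?e j) N) \<partial>?P)"
    using em by (subst nn_integral_sum) (auto simp: nn_integral_cmult_indicator)
  also have "\<dots> \<le> (\<integral>\<^sup>+N. ennreal ((l2_norm (\<lambda>x. T N x - f x))\<^sup>2) \<partial>?P)"
  proof (rule nn_integral_mono)
    fix N assume "N \<in> space ?P"
    then have "N \<in> space (sample_space n)" by (simp only: spP)
    with T have TN: "T N \<in> l2_space"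
      using measurable_space[of T "sample_space n" l2_borel N] unfolding space_l2_borel estimators_def by simp
    have "(\<Sum>j\<in>J. ennreal (a\<^sup>2) * indicator (?e j) N) = ennreal (\<Sum>j\<in>J. a\<^sup>2 * indicator (?e j) N)"
    proof -
      have "ennreal (a\<^sup>2) * indicator X N = ennreal (a\<^sup>2 * indicator X N)" for X
        by (auto simp: indicator_def)
      then show ?thesis by simp
    qed
    also have "(\<Sum>j\<in>J. a\<^sup>2 * indicator (?e j) N) \<le> (\<Sum>j\<in>J. (fourier_coeff (\<lambda>x. T N x - f x) j)\<^sup>2)"
    proof (rule sum_mono)
      fix j assume j: "j \<in> J"
      have "\<bar>a\<bar> \<le> \<bar>fourier_coeff (T N) j - fourier_coeff f j\<bar>" if "N \<in> ?e j"
        using that a by (auto simp: coordinate_error_def coeff[OF j] split: if_splits)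
      then show "a\<^sup>2 * indicator (?e j) N \<le> (fourier_coeff (\<lambda>x. T N x - f x) j)\<^sup>2"
        unfolding fourier_coeff_diff[OF TN f] by (auto simp: indicator_def abs_le_square_iff)
    qed
    also have "\<dots> \<le> (l2_norm (\<lambda>x. T N x - f x))\<^sup>2"
      by (rule bessel_inequality[OF l2_space_diff[OF TN f] J])
    finally show "(\<Sum>j\<in>J. ennreal (a\<^sup>2) * indicator (?e j) N) \<le> ennreal ((l2_norm (\<lambda>x. T N x - f x))\<^sup>2)"
      by (simp add: ennreal_leI)
  qed
  also have "\<dots> = risk n P T f" by (simp add: risk_def)
  finally show ?thesis .
qed

text \<open>The average of \<open>e S j\<close> over all vertices is an average over the edges in direction \<open>j\<close>, hence
  at least \<open>\<delta> / 2\<close>; some vertex reaches the sum of these averages.\<close>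

lemma hypercube_average:
  fixes e :: "'a set \<Rightarrow> 'a \<Rightarrow> real" and \<delta> :: real
  assumes J: "finite J" and pair: "\<And>j S. j \<in> J \<Longrightarrow> S \<subseteq> J - {j} \<Longrightarrow> \<delta> \<le> e S j + e (insert j S) j"
  shows "\<exists>S\<subseteq>J. card J * \<delta> / 2 \<le> (\<Sum>j\<in>J. e S j)"
proof (rule ccontr)
  assume "\<not> ?thesis"
  then have less: "(\<Sum>j\<in>J. e S j) < card J * \<delta> / 2" if "S \<in> Pow J" for S using that by (auto simp: not_le)
  have edge: "2 ^ card J * \<delta> / 2 \<le> (\<Sum>S\<in>Pow J. e S j)" if j: "j \<in> J" for j
  proof -
    let ?K = "J - {j}"
    have Jj: "J = insert j ?K" using j by auto
    have card: "card J = Suc (card ?K)" by (rule card_Suc_Diff1[OF J j, symmetric])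
    have inj: "inj_on (insert j) (Pow ?K)" by (auto simp: inj_on_def)
    have "2 ^ card J * \<delta> / 2 = 2 ^ card ?K * \<delta>" unfolding card power_Suc by simp
    also have "\<dots> = (\<Sum>S\<in>Pow ?K. \<delta>)" using J by (simp add: card_Pow)
    also have "\<dots> \<le> (\<Sum>S\<in>Pow ?K. e S j + e (insert j S) j)"
      using pair[OF j] by (intro sum_mono) auto
    also have "\<dots> = (\<Sum>S\<in>Pow ?K. e S j) + (\<Sum>S\<in>insert j ` Pow ?K. e S j)"
      by (simp add: sum.distrib sum.reindex[OF inj])
    also have "\<dots> = (\<Sum>S\<in>Pow ?K \<union> insert j ` Pow ?K. e S j)"
      using J by (intro sum.union_disjoint[symmetric]) auto
    also have "Pow ?K \<union> insert j ` Pow ?K = Pow J" using Pow_insert[of j ?K] unfolding Jj[symmetric] by (rule sym)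
    finally show ?thesis .
  qed
  have "(\<Sum>j\<in>J. 2 ^ card J * \<delta> / 2) \<le> (\<Sum>j\<in>J. \<Sum>S\<in>Pow J. e S j)" by (intro sum_mono edge)
  also have "\<dots> = (\<Sum>S\<in>Pow J. \<Sum>j\<in>J. e S j)" by (rule sum.swap)
  also have "\<dots> < (\<Sum>S\<in>Pow J. card J * \<delta> / 2)" using J less by (intro sum_strict_mono) auto
  also have "\<dots> = (\<Sum>j\<in>J. 2 ^ card J * \<delta> / 2)" using J by (simp add: card_Pow)
  finally show False by simp
qed

text \<open>All vertices are at least \<open>L / 4\<close>, and neighbours differ by a multiple \<open>2 * a\<close> of one basis function,
  so the two-point bound applies to every edge with \<open>m = L / 4\<close> and \<open>D = 2 * a * sqrt 2\<close>.\<close>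

lemma assouad_bound:
  assumes w: "weight_sequence \<gamma>" and L: "L > 0" and a: "a \<ge> 0"
    and dev: "a * sqrt 2 * (2 * real k + 1) \<le> L / 4"
    and smooth: "a\<^sup>2 * (2 * real k + 1) * (\<gamma> (int k))\<^sup>2 \<le> L\<^sup>2 / 4"
    and P: "\<forall>f\<in>intensity_class \<gamma> L. poisson_law f (P f)"
    and T: "T \<in> estimators n"
  shows "\<exists>f\<in>intensity_class \<gamma> L.
    ennreal (a\<^sup>2 * (2 * real k + 1) * exp (- (8 * (real n * a\<^sup>2) / L)) / 4) \<le> risk n (P f) T f"
proof -
  define J where "J = {- int k..int k}"
  define v where "v S = vertex_intensity (L / 2) a k S" for S
  define c where "c j = (if j = 0 then L / 2 else 0)" for j :: int
  define \<delta> where "\<delta> = exp (- (8 * (real n * a\<^sup>2) / L)) / 2"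
  define e where "e S j = measure (PiM {1..n} (\<lambda>_. P (v S))) (coordinate_error n T c S j)" for S j
  have J: "finite J" "card J = 2 * k + 1" by (auto simp: J_def)
  have cls: "v S \<in> intensity_class \<gamma> L" for S
    unfolding v_def by (rule vertex_intensity_in_class[OF w L a _ smooth]) (use dev L in simp)
  have law: "poisson_law (v S) (P (v S))" for S using P cls by blast
  have "\<delta> \<le> e S j + e (insert j S) j" if j: "j \<in> J" and S: "S \<subseteq> J - {j}" for j S
  proof -
    have jS: "j \<notin> S" using S by auto
    have bounds: "L / 4 \<le> v S x \<and> L / 4 \<le> v (insert j S) x \<and> \<bar>v S x - v (insert j S) x\<bar> \<le> 2 * a * sqrt 2" for x
    proof (intro conjI)
      show "L / 4 \<le> v S x" "L / 4 \<le> v (insert j S) x"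
        using vertex_intensity_deviation[OF a, of "L / 2" k S x]
          vertex_intensity_deviation[OF a, of "L / 2" k "insert j S" x] dev
        unfolding v_def by linarith+
      have "v (insert j S) x - v S x = 2 * a * trig_basis j x"
        unfolding v_def using vertex_intensity_flip j jS by (simp add: J_def)
      then have "\<bar>v S x - v (insert j S) x\<bar> = 2 * a * \<bar>trig_basis j x\<bar>"
        using a by (subst abs_minus_commute) (simp add: abs_mult)
      also have "\<dots> \<le> 2 * a * sqrt 2" using a by (intro mult_left_mono trig_basis_bound) auto
      finally show "\<bar>v S x - v (insert j S) x\<bar> \<le> 2 * a * sqrt 2" .
    qed
    have "exp (- (real n * (2 * a * sqrt 2)\<^sup>2 / (4 * (L / 4)))) / 2
        \<le> measure (PiM {1..n} (\<lambda>_. P (v S))) (coordinate_error n T c S j)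
          + measure (PiM {1..n} (\<lambda>_. P (v (insert j S)))) (space (sample_space n) - coordinate_error n T c S j)"
      by (rule poisson_sample_error_sum[OF law law _ _ _ bounds coordinate_error_sets[OF T]])
         (simp_all only: v_def vertex_intensity_def integrable_trig_polynomial zero_less_divide_iff, use L in simp)
    moreover have "space (sample_space n) - coordinate_error n T c S j = coordinate_error n T c (insert j S) j"
      using jS by (auto simp: coordinate_error_def)
    moreover have exponent: "real n * (2 * a * sqrt 2)\<^sup>2 / (4 * (L / 4)) = 8 * (real n * a\<^sup>2) / L"
      by (simp add: power_mult_distrib)
    ultimately show ?thesis unfolding e_def \<delta>_def by (simp only: exponent)
  qed
  from hypercube_average[OF J(1), of \<delta> e, OF this] obtain S
    where S: "card J * \<delta> / 2 \<le> (\<Sum>j\<in>J. e S j)" by auto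
  have "a\<^sup>2 * (2 * real k + 1) * exp (- (8 * (real n * a\<^sup>2) / L)) / 4 = a\<^sup>2 * (card J * \<delta> / 2)"
    by (simp add: J(2) \<delta>_def)
  also have "\<dots> \<le> a\<^sup>2 * (\<Sum>j\<in>J. e S j)" using S by (intro mult_left_mono) auto
  finally have "ennreal (a\<^sup>2 * (2 * real k + 1) * exp (- (8 * (real n * a\<^sup>2) / L)) / 4)
      \<le> ennreal (a\<^sup>2 * (\<Sum>j\<in>J. e S j))" by (rule ennreal_leI)
  also have "\<dots> \<le> risk n (P (v S)) T (v S)"
    unfolding e_def
  proof (rule risk_ge_coordinate_errors[OF T _ law J(1) a])
    show "v S \<in> l2_space" using cls by (auto simp: intensity_class_def)
    show "fourier_coeff (v S) j = c j + (if j \<in> S then a else - a)" if "j \<in> J" for j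
      using that by (simp add: v_def vertex_intensity_def fourier_coeff_trig_polynomial J_def vertex_coeff_def c_def)
  qed
  finally show ?thesis using cls by blast
qed

section \<open>The lower bound\<close>

text \<open>The infimum is a lower bound for each of its terms, so the minimum of the two terms is at least their maximum
  divided by \<open>\<eta>\<close>.\<close>

lemma balanced_terms:
  assumes w: "weight_sequence \<gamma>" and eta: "\<eta> \<ge> 1" and n: "n \<ge> 1"
    and inf: "1 / \<eta> = (INF n\<in>{1..}. min (sq_bias \<gamma> (k n)) (var_term n (k n)) / rate \<gamma> k n)"
  shows "rate \<gamma> k n \<le> \<eta> * var_term n (k n)" "var_term n (k n) \<le> \<eta> * sq_bias \<gamma> (k n)"
proof -
  have pos: "\<gamma> j > 0" for j using w by (auto simp: weight_sequence_def)
  have sq: "sq_bias \<gamma> (k m) > 0" for m using pos[of "int (k m)"] by (simp add: sq_bias_def)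
  have rate_pos: "rate \<gamma> k m > 0" for m using sq[of m] by (simp add: rate_def less_max_iff_disj)
  have "1 / \<eta> \<le> min (sq_bias \<gamma> (k n)) (var_term n (k n)) / rate \<gamma> k n"
    unfolding inf
  proof (rule cINF_lower)
    show "bdd_below ((\<lambda>n. min (sq_bias \<gamma> (k n)) (var_term n (k n)) / rate \<gamma> k n) ` {1..})"
      by (rule bdd_belowI[of _ 0]) (use sq rate_pos in \<open>auto simp: less_imp_le var_term_def\<close>)
  qed (use n in auto)
  then have "1 / \<eta> * rate \<gamma> k n \<le> min (sq_bias \<gamma> (k n)) (var_term n (k n))"
    by (simp only: pos_le_divide_eq[OF rate_pos])
  from mult_left_mono[OF this, of \<eta>]
  have "rate \<gamma> k n \<le> \<eta> * min (sq_bias \<gamma> (k n)) (var_term n (k n))" using eta by simp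
  moreover have "\<eta> * min (sq_bias \<gamma> (k n)) (var_term n (k n)) \<le> \<eta> * sq_bias \<gamma> (k n)"
      "\<eta> * min (sq_bias \<gamma> (k n)) (var_term n (k n)) \<le> \<eta> * var_term n (k n)"
    using eta by (auto intro!: mult_left_mono)
  ultimately have *: "rate \<gamma> k n \<le> \<eta> * sq_bias \<gamma> (k n)" "rate \<gamma> k n \<le> \<eta> * var_term n (k n)"
    by linarith+
  show "rate \<gamma> k n \<le> \<eta> * var_term n (k n)" by fact
  show "var_term n (k n) \<le> \<eta> * sq_bias \<gamma> (k n)" using *(1) by (simp add: rate_def)
qed

text \<open>Each of the \<open>2 * k + 1\<close> terms of the series with index in \<open>{- k..k}\<close> is at least the one with index \<open>k\<close>.\<close>

lemma dimension_le_weight: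
  assumes w: "weight_sequence \<gamma>" and \<Gamma>: "((\<lambda>j. 1 / (\<gamma> j)\<^sup>2) has_sum \<Gamma>) UNIV"
  shows "2 * real k + 1 \<le> \<Gamma> * (\<gamma> (int k))\<^sup>2"
proof -
  have pos: "\<gamma> j > 0" for j using w by (auto simp: weight_sequence_def)
  have "(2 * real k + 1) / (\<gamma> (int k))\<^sup>2 = (\<Sum>j\<in>{- int k..int k}. 1 / (\<gamma> (int k))\<^sup>2)" by simp
  also have "\<dots> \<le> (\<Sum>j\<in>{- int k..int k}. 1 / (\<gamma> j)\<^sup>2)"
  proof (intro sum_mono frac_le power_mono)
    show "0 < (\<gamma> j)\<^sup>2" "0 \<le> \<gamma> j" for j using pos[of j] by auto
    show "\<gamma> j \<le> \<gamma> (int k)" if "j \<in> {- int k..int k}" for j by (rule weight_le[OF w that])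
  qed auto
  also have "\<dots> \<le> \<Gamma>"
    by (rule has_sum_mono_neutral[OF has_sum_finite \<Gamma>]) auto
  finally show ?thesis using pos[of "int k"] by (simp add: field_simps)
qed

theorem theorem3p3:
  fixes L \<eta> \<Gamma> :: real
  assumes "L > 0" and "\<eta> \<ge> 1"
  shows "\<exists>c>0. \<forall>(\<gamma> :: int \<Rightarrow> real) (k :: nat \<Rightarrow> nat) (P :: (real \<Rightarrow> real) \<Rightarrow> real measure measure).
    weight_sequence \<gamma> \<longrightarrow>
    optimal_dims \<gamma> k \<longrightarrow>
    ((\<lambda>j. 1 / (\<gamma> j)\<^sup>2) has_sum \<Gamma>) UNIV \<longrightarrow>
    1 / \<eta> = (INF n\<in>{1..}. min (sq_bias \<gamma> (k n)) (var_term n (k n)) / rate \<gamma> k n) \<longrightarrow>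
    (\<forall>f\<in>intensity_class \<gamma> L. poisson_law f (P f)) \<longrightarrow>
    (\<forall>n\<ge>1. ennreal (c * rate \<gamma> k n)
        \<le> (INF T\<in>estimators n. SUP f\<in>intensity_class \<gamma> L. risk n (P f) T f))"
proof -
  \<comment> \<open>The constant 32 keeps the deviation of the cube from its centre, whose square is at most
    \<open>2 * \<zeta> * \<eta> * max 1 \<Gamma>\<close>, within \<open>L / 4\<close>; the maximum with 1 makes \<open>\<zeta>\<close> positive for every real \<open>\<Gamma>\<close>.\<close>
  define \<zeta> where "\<zeta> = L\<^sup>2 / (32 * \<eta> * max 1 \<Gamma>)"
  have \<zeta>: "\<zeta> > 0" using assms by (auto simp: \<zeta>_def intro!: divide_pos_pos mult_pos_pos)
  have \<zeta>_eq: "\<zeta> * \<eta> * max 1 \<Gamma> = L\<^sup>2 / 32" using assms by (simp add: \<zeta>_def)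
  define c where "c = \<zeta> * exp (- (8 * \<zeta> / L)) / (4 * \<eta>)"
  show ?thesis
  proof (intro exI[of _ c] conjI allI impI INF_greatest)
    show "c > 0" using \<zeta> assms by (simp add: c_def)
  next
    fix \<gamma> :: "int \<Rightarrow> real" and k :: "nat \<Rightarrow> nat" and P :: "(real \<Rightarrow> real) \<Rightarrow> real measure measure"
    fix n :: nat and T
    assume w: "weight_sequence \<gamma>" and \<Gamma>: "((\<lambda>j. 1 / (\<gamma> j)\<^sup>2) has_sum \<Gamma>) UNIV"
      and inf: "1 / \<eta> = (INF n\<in>{1..}. min (sq_bias \<gamma> (k n)) (var_term n (k n)) / rate \<gamma> k n)"
      and P: "\<forall>f\<in>intensity_class \<gamma> L. poisson_law f (P f)" and n: "n \<ge> 1" and T: "T \<in> estimators n"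
    define d where "d = 2 * real (k n) + 1"
    define g where "g = (\<gamma> (int (k n)))\<^sup>2"
    define a where "a = sqrt (\<zeta> / n)"
    have "\<gamma> (int (k n)) > 0" using w by (simp add: weight_sequence_def)
    then have g: "g > 0" by (simp add: g_def)
    have a: "a \<ge> 0" and a2: "a\<^sup>2 = \<zeta> / n" using \<zeta> n by (auto simp: a_def)
    have d: "d > 0" by (simp add: d_def)
    have dim: "d \<le> max 1 \<Gamma> * g"
    proof -
      have "d \<le> \<Gamma> * g" unfolding d_def g_def by (rule dimension_le_weight[OF w \<Gamma>])
      also have "\<dots> \<le> max 1 \<Gamma> * g" using g by (intro mult_right_mono) auto
      finally show ?thesis .
    qed
    have "d / n \<le> \<eta> / g"
      using balanced_terms(2)[OF w assms(2) n inf] by (simp add: var_term_def sq_bias_def d_def g_def)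
    then have smooth0: "a\<^sup>2 * d * g \<le> \<zeta> * \<eta>"
      using \<zeta> g n by (simp add: a2 field_simps)
    have "\<zeta> * \<eta> \<le> \<zeta> * \<eta> * max 1 \<Gamma>"
      using \<zeta> assms mult_left_mono[of 1 "max 1 \<Gamma>" "\<zeta> * \<eta>"] by simp
    then have smooth: "a\<^sup>2 * d * g \<le> L\<^sup>2 / 4"
      using smooth0 \<zeta>_eq zero_le_power2[of L] by linarith
    have "(a * sqrt 2 * d)\<^sup>2 = 2 * (a\<^sup>2 * d) * d" by (simp add: power_mult_distrib power2_eq_square)
    also have "\<dots> \<le> 2 * (a\<^sup>2 * d) * (max 1 \<Gamma> * g)"
      using dim d by (intro mult_left_mono) auto
    also have "\<dots> = 2 * max 1 \<Gamma> * (a\<^sup>2 * d * g)" by simp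
    also have "\<dots> \<le> 2 * max 1 \<Gamma> * (\<zeta> * \<eta>)" by (intro mult_left_mono smooth0) auto
    also have "\<dots> = 2 * (\<zeta> * \<eta> * max 1 \<Gamma>)" by simp
    also have "\<dots> = (L / 4)\<^sup>2" unfolding \<zeta>_eq by (simp add: power2_eq_square)
    finally have dev: "a * sqrt 2 * d \<le> L / 4"
      by (rule power2_le_imp_le) (use assms in simp)
    obtain f where f: "f \<in> intensity_class \<gamma> L"
      and risk: "ennreal (a\<^sup>2 * d * exp (- (8 * (real n * a\<^sup>2) / L)) / 4) \<le> risk n (P f) T f"
      using assouad_bound[OF w assms(1) a dev[unfolded d_def] smooth[unfolded d_def g_def] P T]
      unfolding d_def by blast
    have "c * rate \<gamma> k n \<le> c * (\<eta> * (d / n))"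
      using balanced_terms(1)[OF w assms(2) n inf] \<zeta> assms
      by (intro mult_left_mono) (auto simp: var_term_def d_def c_def)
    also have "\<dots> = a\<^sup>2 * d * exp (- (8 * (real n * a\<^sup>2) / L)) / 4"
      using n assms by (simp add: c_def a2 mult_ac)
    finally have "ennreal (c * rate \<gamma> k n) \<le> risk n (P f) T f"
      using risk order_trans ennreal_leI by blast
    also have "\<dots> \<le> (SUP f\<in>intensity_class \<gamma> L. risk n (P f) T f)" using f by (rule SUP_upper)
    finally show "ennreal (c * rate \<gamma> k n) \<le> (SUP f\<in>intensity_class \<gamma> L. risk n (P f) T f)" .
  qed
qed

end
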